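(* Let $0\le\alpha,\beta\le 2$, fix $\varepsilon>0$, and let $c = \dfrac{1}{\max(\alpha+\beta-1,\,2)}$. There exists $C_\varepsilon>0$ such that the following holds: for all $\delta\in(0,1]$ and $K_\alpha,K_\beta\ge 1$, and for any $(\delta,\beta,K_\beta)$-set of balls $P$ and any $(\delta,\alpha,K_\alpha)$-set of tubes $\mathbb{T}$ contained in $[0,1]^2$, $$I(P,\mathbb{T}) \le C_\varepsilon\, \delta^{-c-\varepsilon}\,(K_\alpha K_\beta)^c\, |P|^{1-c}\,|\mathbb{T}|^{1-c}.$$
   Context: A $\delta$-ball is a ball of radius $\delta$ in $\mathbb{R}^2$; a $\delta$-tube is a $\delta\times 1$ rectangle in $\mathbb{R}^2$ (any orientation). For a set $P$ of $\delta$-balls and a set $\mathbb{T}$ of $\delta$-tubes, $I(P,\mathbb{T})$ is the number of pairs $(p,t)\in P\times\mathbb{T}$ with $p\cap t\ne\emptyset$. $|\cdot|$ denotes cardinality. For $0\le\beta\le 2$ and $K\ge 1$ (which may depend on $\delta$), a set $P$ of $\delta$-balls contained in $[0,1]^2$ is a $(\delta,\beta,K)$-set of balls if for every $w\in[\delta,1]$ and every ball $B_w$ of radius $w$, $\#\{p\in P: p\subset B_w\}\le K (w/\delta)^\beta$. For $0\le\alpha\le 2$ and $K\ge 1$, a set $\mathbb{T}$ of $\delta$-tubes contained in $[0,1]^2$ is a $(\delta,\alpha,K)$-set of tubes if for every $w\in[\delta,1]$ and every $w\times 2$ rectangle $T_w$, $\#\{t\in\mathbb{T}: t\subset T_w\}\le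 K (w/\delta)^\alpha$. *)

theory Defs
  imports "HOL-Analysis.Analysis"
begin

text \<open>All balls and rectangles are closed. Containment of one ball (or rectangle) in another is
  the same for the open versions, so this choice matters only for tangential incidences, which are
  counted.\<close>

definition is_ball :: "real \<Rightarrow> (real^2) set \<Rightarrow> bool" where
  "is_ball r B \<longleftrightarrow> (\<exists>x. B = cball x r)"

text \<open>An \<open>a \<times> b\<close> rectangle of arbitrary orientation: \<open>u\<close>, \<open>v\<close> are the directions of the sides of
  length \<open>a\<close> and \<open>b\<close>, and \<open>x\<close> is a corner.\<close>

definition is_rectangle :: "real \<Rightarrow> real \<Rightarrow> (real^2) set \<Rightarrow> bool" where
  "is_rectangle a b R \<longleftrightarrow>
     (\<exists>x u v. norm u = 1 \<and> norm v = 1 \<and> u \<bullet> v = 0 \<and>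
        R = {x + s *\<^sub>R u + t *\<^sub>R v | s t. 0 \<le> s \<and> s \<le> a \<and> 0 \<le> t \<and> t \<le> b})"

definition is_tube :: "real \<Rightarrow> (real^2) set \<Rightarrow> bool" where
  "is_tube \<delta> t \<longleftrightarrow> is_rectangle \<delta> 1 t"

definition unit_square :: "(real^2) set" where
  "unit_square = cbox 0 One"

text \<open>Since \<^const>\<open>card\<close> is 0 on infinite sets, finiteness is part of the counting bounds
  in the next two definitions.\<close>

definition ball_set :: "real \<Rightarrow> real \<Rightarrow> real \<Rightarrow> (real^2) set set \<Rightarrow> bool" where
  "ball_set \<delta> \<beta> K P \<longleftrightarrow>
     (\<forall>p\<in>P. is_ball \<delta> p \<and> p \<subseteq> unit_square) \<and>
     (\<forall>w B. \<delta> \<le> w \<and> w \<le> 1 \<and> is_ball w B \<longrightarrow>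
        finite {p \<in> P. p \<subseteq> B} \<and> real (card {p \<in> P. p \<subseteq> B}) \<le> K * (w / \<delta>) powr \<beta>)"

definition tube_set :: "real \<Rightarrow> real \<Rightarrow> real \<Rightarrow> (real^2) set set \<Rightarrow> bool" where
  "tube_set \<delta> \<alpha> K T \<longleftrightarrow>
     (\<forall>t\<in>T. is_tube \<delta> t \<and> t \<subseteq> unit_square) \<and>
     (\<forall>w R. \<delta> \<le> w \<and> w \<le> 1 \<and> is_rectangle w 2 R \<longrightarrow>
        finite {t \<in> T. t \<subseteq> R} \<and> real (card {t \<in> T. t \<subseteq> R}) \<le> K * (w / \<delta>) powr \<alpha>)"

definition incidences :: "(real^2) set set \<Rightarrow> (real^2) set set \<Rightarrow> nat" where
  "incidences P T = card {(p, t). p \<in> P \<and> t \<in> T \<and> p \<inter> t \<noteq> {}}"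

end

theory Submission
  imports Defs
begin

text \<open>
  Balls are replaced by their centres \<open>(x, y)\<close> and tubes by lines \<open>y = m x + b\<close>, after exchanging the
  axes for steep tubes. An incidence then forces \<open>\<bar>y - m x - b\<bar> \<le> 4 \<delta>\<close>. Let \<open>J d\<close> be the
  number of pairs within about \<open>d\<close> of each other, smoothed and divided by \<open>d\<close>; it is the quantity
  \<open>total_inc\<close> below. Up to constants the incidence number is at most \<open>\<delta> J (8 \<delta>)\<close>, and trivially
  \<open>J d \<le> |P| |T| / (2 d)\<close>. So everything rests on how much \<open>J\<close> can change from one dyadic scale to the next.

  The smoothing is a box in line space, and a box of side \<open>4 d\<close> is a union of four translates of a box
  of side \<open>2 d\<close>. Hence \<open>J d - J (2 d)\<close> is exactly an integral \<open>\<integral> N F\<close> over line space, where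
  \<open>N\<close> is the density of the given lines at scale \<open>d\<close> and \<open>F\<close> adds up, over the points, a profile
  supported within \<open>4 d\<close> of the pencil of lines through the point and with mean zero across it
  (lemma \<open>total_inc_diff\<close>). Cauchy-Schwarz separates lines and points. The norm of \<open>N\<close> is controlled
  by the spacing of the tubes. The square of the norm of \<open>F\<close> is a sum over pairs of points of the inner
  products of their profiles. For non-negative profiles these decay like \<open>1 / r\<close> in the distance \<open>r\<close> of
  the points, but cancellation gives \<open>d / r\<^sup>2\<close> (lemma \<open>gram_bounds\<close>), which is summable up to
  a logarithm against a point set of dimension at most 2. This elementary almost-orthogonality takes
  the place of a Fourier-analytic estimate of the high frequencies. The outcome (lemma \<open>scale_step\<close>)
  is, up to a logarithm,
  \<open>|J d - J (2 d)| \<lesssim> (|P| |T| K\<^sub>\<alpha> K\<^sub>\<beta>)\<^bsup>1/2\<^esup> (d / \<delta>)\<^bsup>(\<alpha>+\<beta>)/2\<^esup> d\<^bsup>-3/2\<^esup>\<close>.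

  Increasing an exponent weakens a spacing condition, so one may assume \<open>\<alpha> + \<beta> \<ge> 3\<close>; this is the
  origin of the maximum in \<open>c\<close>. Then the differences grow with \<open>d\<close>. Summing them up to the scale
  \<open>\<rho>\<close> at which they match the trivial bound \<open>|P| |T| / \<rho>\<close> gives the claim
  (lemma \<open>incidence_bound\<close>).
\<close>

section \<open>Smoothed point-line incidences\<close>

text \<open>
  The interval is half-open so that a box is the disjoint union of two boxes of half its width
  (\<open>box_avg_double\<close>), which makes the passage between consecutive scales an identity.
\<close>

definition box_avg :: "real \<Rightarrow> real \<Rightarrow> real" where
  "box_avg d s = indicator {-d..<d} s / (2 * d)"

definition cell :: "real \<Rightarrow> real \<Rightarrow> real \<Rightarrow> real \<times> real \<Rightarrow> real" where
  "cell d m b z = box_avg d (fst z - m) * box_avg d (snd z - b)"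

text \<open>
  A point of line space is a pair of a slope and an intercept. The line \<open>(m, b)\<close> is blurred over a square
  of side \<open>2 d\<close>, and the blurred line is tested for passing within vertical distance \<open>d\<close> of the
  point \<open>(x, y)\<close>.
\<close>

definition smooth_inc :: "real \<Rightarrow> real \<Rightarrow> real \<Rightarrow> real \<Rightarrow> real \<Rightarrow> real" where
  "smooth_inc d x y m b =
     (\<integral>z. cell d m b z * box_avg d (y - fst z * x - snd z) \<partial>lborel)"

text \<open>
  The profile of a point with abscissa \<open>x\<close> as a function of the vertical offset \<open>u\<close>. The four
  shifts are the effect on the offset of moving a line by \<open>(\<plusminus> d, \<plusminus> d)\<close> in line space.
\<close>

definition osc :: "real \<Rightarrow> real \<Rightarrow> real \<Rightarrow> real" where
  "osc d x u = box_avg d u -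
     (box_avg (2*d) (u + d*x + d) + box_avg (2*d) (u + d*x - d)
      + box_avg (2*d) (u - d*x + d) + box_avg (2*d) (u - d*x - d)) / 4"

lemma measurable_box_avg [measurable]: "box_avg d \<in> borel_measurable borel"
  unfolding box_avg_def by measurable

lemma measurable_osc [measurable]: "osc d x \<in> borel_measurable borel"
  unfolding osc_def by measurable

lemma measurable_fst_snd_borel [measurable]:
  "fst \<in> borel_measurable (borel :: (real \<times> real) measure)"
  "snd \<in> borel_measurable (borel :: (real \<times> real) measure)"
  by (auto intro!: borel_measurable_continuous_onI continuous_intros)

lemma measurable_cell [measurable]: "cell d m b \<in> borel_measurable borel"
  unfolding cell_def by measurable

lemma box_avg_nonneg: "0 < d \<Longrightarrow> 0 \<le> box_avg d s"
  by (simp add: box_avg_def)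

lemma box_avg_le: "0 < d \<Longrightarrow> box_avg d s \<le> 1 / (2*d)"
  by (simp add: box_avg_def indicator_def field_simps)

lemma box_avg_eq_0: "d < \<bar>s\<bar> \<Longrightarrow> box_avg d s = 0"
  by (auto simp: box_avg_def indicator_def)

lemma box_avg_eq: "\<bar>s\<bar> < d \<Longrightarrow> box_avg d s = 1 / (2*d)"
  by (simp add: box_avg_def indicator_def abs_less_iff)

lemma box_avg_double:
  assumes "0 < d"
  shows "box_avg (2*d) s = (box_avg d (s - d) + box_avg d (s + d)) / 2"
  using assms by (auto simp: box_avg_def indicator_def)

lemma has_bochner_integral_box_avg:
  assumes "0 < d"
  shows "has_bochner_integral lborel (\<lambda>s. box_avg d (s + a)) 1"
proof -
  have "has_bochner_integral lborel (\<lambda>s. indicator {-d-a..<d-a} s *\<^sub>R (1/(2*d))) 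
     (measure lborel {-d-a..<d-a} *\<^sub>R (1/(2*d)))"
    by (rule has_bochner_integral_indicator) (use assms in simp_all)
  moreover have "(\<lambda>s. indicator {-d-a..<d-a} s *\<^sub>R (1/(2*d))) = (\<lambda>s. box_avg d (s + a))"
    by (auto simp: box_avg_def indicator_def fun_eq_iff)
  ultimately show ?thesis using assms by simp
qed

lemma integrable_lborel_bounded_support:
  fixes f :: "'a::euclidean_space \<Rightarrow> real"
  assumes "f \<in> borel_measurable borel" and "\<And>z. \<bar>f z\<bar> \<le> C" and "\<And>z. z \<notin> cbox a b \<Longrightarrow> f z = 0"
  shows "integrable lborel f"
proof (rule Bochner_Integration.integrable_bound)
  show "integrable lborel (\<lambda>z. indicator (cbox a b) z * C)"
    by (rule integrable_mult_left) (auto simp: emeasure_lborel_cbox_eq)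
  show "f \<in> borel_measurable lborel" using assms(1) by simp
  show "AE x in lborel. norm (f x) \<le> norm (indicator (cbox a b) x * C)"
  proof (rule AE_I2)
    fix x
    show "norm (f x) \<le> norm (indicator (cbox a b) x * C)"
      using assms(2)[of x] assms(3)[of x] by (cases "x \<in> cbox a b") auto
  qed
qed

lemma lborel_integral_shift:
  fixes f :: "'a::euclidean_space \<Rightarrow> real"
  assumes [measurable]: "f \<in> borel_measurable borel"
  shows "(\<integral>z. f (a + z) \<partial>lborel) = (\<integral>z. f z \<partial>lborel)"
proof -
  have "(\<integral>z. f z \<partial>lborel) = (\<integral>z. f z \<partial>distr lborel borel ((+) a))"
    by (simp add: lborel_distr_plus)
  also have "\<dots> = (\<integral>z. f (a + z) \<partial>lborel)"
    by (rule integral_distr) auto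
  finally show ?thesis by simp
qed

lemma cell_nonneg: "0 < d \<Longrightarrow> 0 \<le> cell d m b z"
  by (simp add: cell_def box_avg_nonneg)

lemma cell_le: "0 < d \<Longrightarrow> cell d m b z \<le> 1 / (4 * d^2)"
  using mult_mono[OF box_avg_le[of d "fst z - m"] box_avg_le[of d "snd z - b"]]
  by (simp add: cell_def box_avg_nonneg power2_eq_square)

lemma cell_eq_0:
  assumes "z \<notin> cbox (m - d, b - d) (m + d, b + d)"
  shows "cell d m b z = 0"
proof -
  have "d < \<bar>fst z - m\<bar> \<or> d < \<bar>snd z - b\<bar>"
    using assms by (cases z) (auto simp: cbox_Pair_eq abs_if)
  then show ?thesis by (auto simp: cell_def box_avg_eq_0)
qed

lemma integrable_cell_mult:
  assumes "0 < d" and [measurable]: "g \<in> borel_measurable borel" and "\<And>z. \<bar>g z\<bar> \<le> C"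
  shows "integrable lborel (\<lambda>z. cell d m b z * g z)"
proof (rule integrable_lborel_bounded_support)
  show "(\<lambda>z. cell d m b z * g z) \<in> borel_measurable borel" by measurable
  show "\<bar>cell d m b z * g z\<bar> \<le> 1 / (4*d^2) * C" for z
    unfolding abs_mult
    by (rule mult_mono) (use assms cell_nonneg[of d m b z] cell_le[of d m b z] in auto)
  show "cell d m b z * g z = 0" if "z \<notin> cbox (m - d, b - d) (m + d, b + d)" for z
    using cell_eq_0[OF that] by simp
qed

lemma integral_cell:
  assumes "0 < d"
  shows "integrable lborel (cell d m b)" and "(\<integral>z. cell d m b z \<partial>lborel) = 1"
proof -
  show I: "integrable lborel (cell d m b)"
    using integrable_cell_mult[OF assms, of "\<lambda>_. 1" 1 m b] by simp
  have "(\<integral>z. cell d m b z \<partial>lborel) = (\<integral>s. \<integral>t. cell d m b (s, t) \<partial>lborel \<partial>lborel)"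
    using I by (subst lborel_pair.integral_fst') (simp_all add: lborel_prod)
  also have "\<dots> = (\<integral>s. box_avg d (s - m) * (\<integral>t. box_avg d (t - b) \<partial>lborel) \<partial>lborel)"
    by (simp add: cell_def)
  also have "\<dots> = 1"
    using has_bochner_integral_integral_eq[OF has_bochner_integral_box_avg[OF assms, of "-m"]]
      has_bochner_integral_integral_eq[OF has_bochner_integral_box_avg[OF assms, of "-b"]] by simp
  finally show "(\<integral>z. cell d m b z \<partial>lborel) = 1" .
qed

lemma smooth_inc_upper:
  assumes "0 < d"
  shows "smooth_inc d x y m b \<le> 1 / (2*d)"
proof -
  have "smooth_inc d x y m b \<le> (\<integral>z. cell d m b z * (1/(2*d)) \<partial>lborel)"
    unfolding smooth_inc_def
  proof (rule integral_mono)
    show "integrable lborel (\<lambda>z. cell d m b z * box_avg d (y - fst z * x - snd z))"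
      by (rule integrable_cell_mult[OF assms, where C = "1/(2*d)"])
         (use box_avg_nonneg[OF assms] box_avg_le[OF assms] in \<open>auto simp: abs_of_nonneg\<close>)
    show "integrable lborel (\<lambda>z. cell d m b z * (1/(2*d)))"
      using integral_cell(1)[OF assms] by simp
    show "cell d m b z * box_avg d (y - fst z * x - snd z) \<le> cell d m b z * (1/(2*d))" for z
      by (rule mult_left_mono[OF box_avg_le[OF assms] cell_nonneg[OF assms]])
  qed
  also have "\<dots> = 1/(2*d)" using integral_cell(2)[OF assms] by simp
  finally show ?thesis .
qed

text \<open>
  If the offset is at most \<open>d / 2\<close>, the lines within \<open>d / 8\<close> of \<open>(m, b)\<close> all pass within
  \<open>d\<close> of the point, and they fill a fixed proportion of the cell.
\<close>

lemma smooth_inc_lower: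
  assumes d: "0 < d" and x: "0 \<le> x" "x \<le> 1" and u: "\<bar>y - m * x - b\<bar> \<le> d / 2"
  shows "1 / (128 * d) \<le> smooth_inc d x y m b"
proof -
  let ?Q = "cbox (m - d/8, b - d/8) (m + d/8, b + d/8)"
  have meas: "measure lborel ?Q = (d/4)^2"
    using d content_Pair[of "m - d/8" "b - d/8" "m + d/8" "b + d/8"]
    by (simp add: power2_eq_square measure_lborel_cbox_eq[symmetric] del: measure_lborel_cbox_eq)
  have "1 / (128*d) = (\<integral>z. indicator ?Q z * (1/(8*d^3)) \<partial>lborel)"
    using d by (simp add: meas power2_eq_square power3_eq_cube)
  also have "\<dots> \<le> smooth_inc d x y m b"
    unfolding smooth_inc_def
  proof (rule integral_mono)
    show "integrable lborel (\<lambda>z. indicator ?Q z * (1/(8*d^3)))"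
      by (rule integrable_mult_left) (auto simp: emeasure_lborel_cbox_eq)
    show "integrable lborel (\<lambda>z. cell d m b z * box_avg d (y - fst z * x - snd z))"
      by (rule integrable_cell_mult[OF d, where C = "1/(2*d)"])
         (use box_avg_nonneg[OF d] box_avg_le[OF d] in \<open>auto simp: abs_of_nonneg\<close>)
    fix z :: "real \<times> real"
    show "indicator ?Q z * (1/(8*d^3)) \<le> cell d m b z * box_avg d (y - fst z * x - snd z)"
    proof (cases "z \<in> ?Q")
      case True
      then have z: "\<bar>fst z - m\<bar> \<le> d/8" "\<bar>snd z - b\<bar> \<le> d/8"
        by (cases z; auto simp: cbox_Pair_eq abs_if)+
      have "\<bar>(fst z - m) * x\<bar> \<le> d/8 * 1"
        unfolding abs_mult by (rule mult_mono) (use z x d in auto)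
      moreover have "y - fst z * x - snd z = (y - m*x - b) - (fst z - m) * x - (snd z - b)"
        by (simp add: algebra_simps)
      ultimately have "\<bar>y - fst z * x - snd z\<bar> < d" "\<bar>fst z - m\<bar> < d" "\<bar>snd z - b\<bar> < d"
        using z u d by linarith+
      then have "box_avg d (y - fst z * x - snd z) = 1/(2*d)" "box_avg d (fst z - m) = 1/(2*d)"
          "box_avg d (snd z - b) = 1/(2*d)"
        by (simp_all add: box_avg_eq)
      then show ?thesis using d by (simp add: cell_def power3_eq_cube indicator_def)
    qed (use d in \<open>simp add: cell_nonneg box_avg_nonneg\<close>)
  qed
  finally show ?thesis .
qed

lemma cell_double:
  assumes "0 < d"
  shows "cell (2*d) m b z = (cell d m b ((d, d) + z) + cell d m b ((d, -d) + z)
     + cell d m b ((-d, d) + z) + cell d m b ((-d, -d) + z)) / 4"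
  unfolding cell_def box_avg_double[OF assms, of "fst z - m"] box_avg_double[OF assms, of "snd z - b"]
  by (simp add: algebra_simps)

lemma abs_osc_le:
  assumes "0 < d"
  shows "\<bar>osc d x u\<bar> \<le> 1 / (2*d)"
proof -
  let ?s = "(box_avg (2*d) (u + d*x + d) + box_avg (2*d) (u + d*x - d)
      + box_avg (2*d) (u - d*x + d) + box_avg (2*d) (u - d*x - d)) / 4"
  have d2: "0 < 2*d" using assms by simp
  have "0 \<le> ?s" "?s \<le> 1/(2*(2*d))"
    using box_avg_nonneg[OF d2] box_avg_le[OF d2, of "u + d*x + d"] box_avg_le[OF d2, of "u + d*x - d"]
      box_avg_le[OF d2, of "u - d*x + d"] box_avg_le[OF d2, of "u - d*x - d"] 
    by simp_all
  moreover have "1/(2*(2*d)) \<le> 1/(2*d)" using assms by (simp add: field_simps)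
  ultimately show ?thesis
    using box_avg_nonneg[OF assms, of u] box_avg_le[OF assms, of u] unfolding osc_def by linarith
qed

lemma osc_eq_0:
  assumes "0 < d" "\<bar>x\<bar> \<le> 1" "4*d < \<bar>u\<bar>"
  shows "osc d x u = 0"
proof -
  have "\<bar>d*x\<bar> \<le> d * 1" unfolding abs_mult by (rule mult_mono) (use assms in auto)
  then have "2*d < \<bar>u + d*x + d\<bar>" "2*d < \<bar>u + d*x - d\<bar>" "2*d < \<bar>u - d*x + d\<bar>" "2*d < \<bar>u - d*x - d\<bar>"
    "d < \<bar>u\<bar>"
    using assms by linarith+
  then show ?thesis unfolding osc_def by (simp add: box_avg_eq_0)
qed

text \<open>
  Both scales carry the same total mass; this cancellation drives the whole argument.
\<close>

lemma has_bochner_integral_osc: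
  assumes "0 < d"
  shows "has_bochner_integral lborel (osc d x) 0"
proof -
  have d2: "0 < 2*d" using assms by simp
  have "has_bochner_integral lborel (\<lambda>u. box_avg d (u + 0) -
     (box_avg (2*d) (u + (d*x + d)) + box_avg (2*d) (u + (d*x - d))
      + box_avg (2*d) (u + (- d*x + d)) + box_avg (2*d) (u + (- d*x - d))) / 4) (1 - (1+1+1+1)/4)"
    by (intro has_bochner_integral_diff has_bochner_integral_divide has_bochner_integral_add
        has_bochner_integral_box_avg assms d2)
  then show ?thesis unfolding osc_def by (simp add: algebra_simps)
qed

text \<open>
  The cell of scale \<open>2 d\<close> is the average of four translates of the cell of scale \<open>d\<close>. Translating
  the integral back moves the shifts onto the offset, so both scales are integrated against the same cell.
\<close>

lemma smooth_inc_diff: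
  assumes d: "0 < d"
  shows "smooth_inc d x y m b - smooth_inc (2*d) x y m b =
     (\<integral>z. cell d m b z * osc d x (y - fst z * x - snd z) \<partial>lborel)"
proof -
  let ?B = "\<lambda>z. box_avg (2*d) (y - fst z * x - snd z)"
  have d2: "0 < 2*d" using d by simp
  have bb: "\<bar>box_avg (2*d) u\<bar> \<le> 1/(2*(2*d))" "\<bar>box_avg d u\<bar> \<le> 1/(2*d)" for u
    using box_avg_nonneg[OF d2, of u] box_avg_le[OF d2, of u] box_avg_nonneg[OF d, of u] 
      box_avg_le[OF d, of u] by (auto simp: abs_of_nonneg)
  have intB: "integrable lborel (\<lambda>z. cell d m b z * box_avg (2*d) (y - fst z * x - snd z + a))" for a
    by (rule integrable_cell_mult[OF d _ bb(1)]) measurable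
  have sh: "integrable lborel (\<lambda>z. cell d m b ((p,q) + z) * ?B z) \<and>
     (\<integral>z. cell d m b ((p,q) + z) * ?B z \<partial>lborel) =
      (\<integral>z. cell d m b z * box_avg (2*d) (y - fst z * x - snd z + (p*x + q)) \<partial>lborel)" for p q
  proof
    let ?g = "\<lambda>z. cell d m b z * box_avg (2*d) (y - fst z * x - snd z + (p*x + q))"
    have eq: "cell d m b ((p,q) + z) * ?B z = ?g ((p,q) + z)" for z
      by (simp add: algebra_simps)
    have gm: "?g \<in> borel_measurable borel" by measurable
    show "(\<integral>z. cell d m b ((p,q) + z) * ?B z \<partial>lborel) = (\<integral>z. ?g z \<partial>lborel)"
      unfolding eq by (rule lborel_integral_shift[OF gm])
    have "integrable (distr lborel borel ((+) (p,q))) ?g"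
      unfolding lborel_distr_plus by (rule intB)
    then show "integrable lborel (\<lambda>z. cell d m b ((p,q) + z) * ?B z)"
      unfolding eq by (subst (asm) integrable_distr_eq) (auto intro: gm)
  qed
  have "smooth_inc (2*d) x y m b = (\<integral>z. (cell d m b ((d,d) + z) * ?B z + cell d m b ((d,-d) + z) * ?B z
     + cell d m b ((-d,d) + z) * ?B z + cell d m b ((-d,-d) + z) * ?B z) / 4 \<partial>lborel)"
    unfolding smooth_inc_def cell_double[OF d] by (simp add: algebra_simps add_divide_distrib)
  also have "\<dots> = ((\<integral>z. cell d m b ((d,d) + z) * ?B z \<partial>lborel) + (\<integral>z. cell d m b ((d,-d) + z) * ?B z \<partial>lborel)
     + (\<integral>z. cell d m b ((-d,d) + z) * ?B z \<partial>lborel) + (\<integral>z. cell d m b ((-d,-d) + z) * ?B z \<partial>lborel)) / 4"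
    using sh by (simp add: Bochner_Integration.integral_add integrable_add)
  also have "\<dots> = ((\<integral>z. cell d m b z * box_avg (2*d) (y - fst z * x - snd z + (d*x + d)) \<partial>lborel)
     + (\<integral>z. cell d m b z * box_avg (2*d) (y - fst z * x - snd z + (d*x + -d)) \<partial>lborel)
     + (\<integral>z. cell d m b z * box_avg (2*d) (y - fst z * x - snd z + (-d*x + d)) \<partial>lborel)
     + (\<integral>z. cell d m b z * box_avg (2*d) (y - fst z * x - snd z + (-d*x + -d)) \<partial>lborel)) / 4"
    using sh by presburger
  also have "\<dots> = (\<integral>z. (cell d m b z * box_avg (2*d) (y - fst z * x - snd z + (d*x + d))
     + cell d m b z * box_avg (2*d) (y - fst z * x - snd z + (d*x + -d))
     + cell d m b z * box_avg (2*d) (y - fst z * x - snd z + (-d*x + d))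
     + cell d m b z * box_avg (2*d) (y - fst z * x - snd z + (-d*x + -d))) / 4 \<partial>lborel)"
    (is "_ = (\<integral>z. ?h z \<partial>lborel)")
    using intB by (simp add: Bochner_Integration.integral_add integrable_add)
  finally have e: "smooth_inc (2*d) x y m b = (\<integral>z. ?h z \<partial>lborel)" .
  have ih: "integrable lborel ?h" using intB by (intro integrable_divide integrable_add) auto
  have i1: "integrable lborel (\<lambda>z. cell d m b z * box_avg d (y - fst z * x - snd z))"
    by (rule integrable_cell_mult[OF d _ bb(2)]) measurable
  show ?thesis
    unfolding e unfolding smooth_inc_def
    by (subst Bochner_Integration.integral_diff[OF i1 ih, symmetric])
       (rule Bochner_Integration.integral_cong, auto simp: osc_def algebra_simps add_divide_distrib)
qed

section \<open>Almost orthogonality\<close>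

text \<open>
  A weight on slopes that dominates 1 where the blurred lines live. It has to be Lipschitz: a sharp cut-off
  would leave boundary terms in the inner products below that decay only like \<open>1 / r\<close>.
\<close>

definition tent :: "real \<Rightarrow> real" where
  "tent m = max 0 (3 - \<bar>m\<bar>)"

text \<open>
  An entry of the Gram matrix of the profiles, in the space of square-integrable functions of a line with
  weight \<open>tent\<close>.
\<close>

definition gram :: "real \<Rightarrow> real \<Rightarrow> real \<Rightarrow> real \<Rightarrow> real \<Rightarrow> real" where
  "gram d x y x' y' =
     (\<integral>z. tent (fst z) * osc d x (y - fst z * x - snd z) * osc d x' (y' - fst z * x' - snd z) \<partial>lborel)"

lemma measurable_tent [measurable]: "tent \<in> borel_measurable borel"
  unfolding tent_def by measurable

lemma tent_bounds: "0 \<le> tent m" "tent m \<le> 3" "3 < \<bar>m\<bar> \<Longrightarrow> tent m = 0" "\<bar>m\<bar> \<le> 2 \<Longrightarrow> 1 \<le> tent m"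
  by (auto simp: tent_def)

lemma tent_lipschitz: "\<bar>tent m - tent m'\<bar> \<le> \<bar>m - m'\<bar>"
  unfolding tent_def by (auto simp: max_def)

lemma abs_integral_le_bounded_support:
  fixes f :: "real \<Rightarrow> real"
  assumes "f \<in> borel_measurable borel" and "\<And>s. \<bar>f s\<bar> \<le> C" and "\<And>s. a < \<bar>s\<bar> \<Longrightarrow> f s = 0" and "0 \<le> a"
  shows "\<bar>\<integral>s. f s \<partial>lborel\<bar> \<le> 2 * a * C"
proof -
  have supp: "f s = 0" if "s \<notin> cbox (-a) a" for s
    using that assms(3)[of s] by (auto simp: abs_if not_le split: if_splits)
  have "\<bar>\<integral>s. f s \<partial>lborel\<bar> \<le> (\<integral>s. \<bar>f s\<bar> \<partial>lborel)"
    by (rule integral_abs_bound)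
  also have "\<dots> \<le> (\<integral>s. indicator {-a..a} s * C \<partial>lborel)"
  proof (rule integral_mono)
    show "integrable lborel (\<lambda>s. \<bar>f s\<bar>)"
      by (rule integrable_abs, rule integrable_lborel_bounded_support[OF assms(1,2) supp])
    show "integrable lborel (\<lambda>s. indicator {-a..a} s * C)"
      by (rule integrable_mult_left) (use assms(4) in \<open>auto simp: emeasure_lborel_Icc_eq\<close>)
    show "\<bar>f s\<bar> \<le> indicator {-a..a} s * C" for s
      using assms(2)[of s] supp[of s] by (cases "s \<in> {-a..a}") auto
  qed
  also have "\<dots> = 2 * a * C" using assms(4) by simp
  finally show ?thesis .
qed

lemma tent_osc_integral_le:
  assumes "0 < d" "\<bar>x\<bar> \<le> 1"
  shows "\<bar>\<integral>m. tent m * osc d x (v - m * s) \<partial>lborel\<bar> \<le> 9 / d"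
proof -
  have "\<bar>\<integral>m. tent m * osc d x (v - m * s) \<partial>lborel\<bar> \<le> 2 * 3 * (3 * (1/(2*d)))"
  proof (rule abs_integral_le_bounded_support)
    show "\<bar>tent m * osc d x (v - m * s)\<bar> \<le> 3 * (1 / (2 * d))" for m
      unfolding abs_mult
      by (rule mult_mono) (use tent_bounds(1,2)[of m] abs_osc_le[OF assms(1)] in auto)
  qed (auto simp: tent_bounds)
  then show ?thesis by simp
qed

text \<open>
  In the variable \<open>w = v - m s\<close> the weight becomes a function with Lipschitz constant \<open>1 / \<bar>s\<bar>\<close>.
  Subtracting its value at \<open>w = 0\<close> is free because the profile has mean zero, and what remains is
  at most \<open>4 d / \<bar>s\<bar>\<close> on the support.
\<close>

lemma tent_osc_integral_decay:
  assumes d: "0 < d" and x: "\<bar>x\<bar> \<le> 1" and s: "s \<noteq> 0"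
  shows "\<bar>\<integral>m. tent m * osc d x (v - m * s) \<partial>lborel\<bar> \<le> 16 * d / s^2"
proof -
  let ?f = "\<lambda>m. tent m * osc d x (v - m * s)"
  have io: "integrable lborel (osc d x)" "(\<integral>w. osc d x w \<partial>lborel) = 0"
    using has_bochner_integral_osc[OF d] by (simp_all add: has_bochner_integral_iff)
  have it: "integrable lborel (\<lambda>w. tent (v/s - w/s) * osc d x w)"
  proof (rule integrable_lborel_bounded_support)
    show "\<bar>tent (v/s - w/s) * osc d x w\<bar> \<le> 3 * (1 / (2 * d))" for w
      unfolding abs_mult
      by (rule mult_mono) (use tent_bounds(1,2)[of "v/s - w/s"] abs_osc_le[OF d] in auto)
    show "tent (v/s - w/s) * osc d x w = 0" if "w \<notin> cbox (-4*d) (4*d)" for w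
    proof -
      have "4*d < \<bar>w\<bar>" using that by (cases "w < 0") auto
      then show ?thesis using osc_eq_0[OF d x] by simp
    qed
  qed measurable
  have "(\<integral>m. ?f m \<partial>lborel) = \<bar>-1/s\<bar> *\<^sub>R (\<integral>w. ?f (v/s + (-1/s) * w) \<partial>lborel)"
    by (rule lborel_integral_real_affine) (use s in simp)
  also have "(\<lambda>w. ?f (v/s + (-1/s) * w)) = (\<lambda>w. tent (v/s - w/s) * osc d x w)"
    using s by (simp add: fun_eq_iff field_simps)
  also have "(\<integral>w. tent (v/s - w/s) * osc d x w \<partial>lborel)
      = (\<integral>w. tent (v/s - w/s) * osc d x w - tent (v/s) * osc d x w \<partial>lborel)"
    using it io by (subst Bochner_Integration.integral_diff) auto
  finally have eq: "(\<integral>m. ?f m \<partial>lborel) = 1 / \<bar>s\<bar> *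
      (\<integral>w. (tent (v/s - w/s) - tent (v/s)) * osc d x w \<partial>lborel)"
    by (simp add: left_diff_distrib)
  have "\<bar>\<integral>w. (tent (v/s - w/s) - tent (v/s)) * osc d x w \<partial>lborel\<bar> \<le> 2 * (4*d) * ((4*d/\<bar>s\<bar>) * (1/(2*d)))"
  proof (rule abs_integral_le_bounded_support)
    show "\<bar>(tent (v/s - w/s) - tent (v/s)) * osc d x w\<bar> \<le> (4*d/\<bar>s\<bar>) * (1/(2*d))" for w
    proof (cases "\<bar>w\<bar> \<le> 4*d")
      case True
      have "\<bar>tent (v/s - w/s) - tent (v/s)\<bar> \<le> \<bar>w\<bar>/\<bar>s\<bar>"
        using tent_lipschitz[of "v/s - w/s" "v/s"] by simp
      also have "\<dots> \<le> 4*d/\<bar>s\<bar>" using True by (simp add: divide_right_mono)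
      finally show ?thesis
        unfolding abs_mult by (rule mult_mono) (use abs_osc_le[OF d] d in auto)
    next
      case False
      then show ?thesis using osc_eq_0[OF d x, of w] d by simp
    qed
    show "(tent (v/s - w/s) - tent (v/s)) * osc d x w = 0" if "4*d < \<bar>w\<bar>" for w
      using osc_eq_0[OF d x that] by simp
  qed (use d in auto)
  also have "\<dots> = 16*d/\<bar>s\<bar>" using d s by (simp add: field_simps)
  finally have b: "\<bar>\<integral>w. (tent (v/s - w/s) - tent (v/s)) * osc d x w \<partial>lborel\<bar> \<le> 16*d/\<bar>s\<bar>" .
  have "\<bar>\<integral>m. ?f m \<partial>lborel\<bar> \<le> 1/\<bar>s\<bar> * (16*d/\<bar>s\<bar>)"
    unfolding eq abs_mult using b by (intro mult_mono) auto
  also have "\<dots> = 16*d/s^2" by (simp add: power2_eq_square)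
  finally show ?thesis .
qed

lemma integrable_gram:
  assumes d: "0 < d" and x: "\<bar>x\<bar> \<le> 1"
  shows "integrable lborel
     (\<lambda>z. tent (fst z) * osc d x (y - fst z * x - snd z) * osc d x' (y' - fst z * x' - snd z))"
proof (rule integrable_lborel_bounded_support)
  let ?R = "\<bar>y\<bar> + 3 + 4*d"
  show "\<bar>tent (fst z) * osc d x (y - fst z * x - snd z) * osc d x' (y' - fst z * x' - snd z)\<bar>
      \<le> 3 * (1/(2*d)) * (1/(2*d))" for z
    unfolding abs_mult
    by (intro mult_mono) (use tent_bounds(1,2)[of "fst z"] abs_osc_le[OF d] d in auto)
  show "tent (fst z) * osc d x (y - fst z * x - snd z) * osc d x' (y' - fst z * x' - snd z) = 0"
    if z: "z \<notin> cbox (-3, -?R) (3, ?R)" for z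
  proof (cases "3 < \<bar>fst z\<bar>")
    case False
    then have R: "?R < \<bar>snd z\<bar>" using z by (cases z) (auto simp: cbox_Pair_eq abs_if split: if_splits)
    have "\<bar>fst z * x\<bar> \<le> 3 * 1" unfolding abs_mult using False x by (intro mult_mono) auto
    then have "4*d < \<bar>y - fst z * x - snd z\<bar>" using R by linarith
    then show ?thesis by (simp add: osc_eq_0[OF d x])
  qed (simp add: tent_bounds)
qed measurable

text \<open>
  Intercepts are replaced by the offset \<open>u\<close> from the first point; the inner integral over slopes then
  has the form treated above, with \<open>s = x' - x\<close>.
\<close>

lemma gram_eq_iterated:
  assumes d: "0 < d" and x: "\<bar>x\<bar> \<le> 1"
  shows "gram d x y x' y' =
     (\<integral>u. osc d x u * (\<integral>m. tent m * osc d x' ((y' - y + u) - m * (x' - x)) \<partial>lborel) \<partial>lborel)"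
proof -
  let ?k = "\<lambda>m u. tent m * osc d x u * osc d x' ((y' - y + u) - m * (x' - x))"
  have "gram d x y x' y' = (\<integral>m. \<integral>b. tent m * osc d x (y - m * x - b) * osc d x' (y' - m * x' - b) \<partial>lborel \<partial>lborel)"
    unfolding gram_def
    using lborel_pair.integral_fst'[OF integrable_gram[OF d x, of y x' y', folded lborel_prod]]
    by (simp add: lborel_prod)
  also have "\<dots> = (\<integral>m. \<integral>u. ?k m u \<partial>lborel \<partial>lborel)"
  proof (rule Bochner_Integration.integral_cong[OF refl])
    fix m :: real
    show "(\<integral>b. tent m * osc d x (y - m * x - b) * osc d x' (y' - m * x' - b) \<partial>lborel) = (\<integral>u. ?k m u \<partial>lborel)"
      by (subst lborel_integral_real_affine[where c = "-1" and t = "y - m * x"]) (simp_all add: algebra_simps)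
  qed
  also have "\<dots> = (\<integral>u. \<integral>m. ?k m u \<partial>lborel \<partial>lborel)"
  proof (rule lborel_pair.Fubini_integral[symmetric])
    have "integrable lborel (\<lambda>z. ?k (fst z) (snd z))"
    proof (rule integrable_lborel_bounded_support)
      show "\<bar>?k (fst z) (snd z)\<bar> \<le> 3 * (1/(2*d)) * (1/(2*d))" for z
        unfolding abs_mult
        by (intro mult_mono) (use tent_bounds(1,2)[of "fst z"] abs_osc_le[OF d] d in auto)
      show "?k (fst z) (snd z) = 0" if z: "z \<notin> cbox (-3, -4*d) (3, 4*d)" for z
      proof (cases "3 < \<bar>fst z\<bar>")
        case False
        then have R: "4*d < \<bar>snd z\<bar>" using z by (cases z) (auto simp: cbox_Pair_eq abs_if split: if_splits)
        show ?thesis by (simp add: osc_eq_0[OF d x R])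
      qed (simp add: tent_bounds)
    qed measurable
    then show "integrable (lborel \<Otimes>\<^sub>M lborel) (\<lambda>(m, u). ?k m u)"
      by (simp add: lborel_prod case_prod_beta')
  qed
  also have "\<dots> = (\<integral>u. osc d x u * (\<integral>m. tent m * osc d x' ((y' - y + u) - m * (x' - x)) \<partial>lborel) \<partial>lborel)"
    by (simp add: ac_simps flip: integral_mult_right_zero)
  finally show ?thesis .
qed

lemma abs_gram_le:
  assumes d: "0 < d" and x: "\<bar>x\<bar> \<le> 1"
    and H: "\<And>u. \<bar>u\<bar> \<le> 4*d \<Longrightarrow> \<bar>\<integral>m. tent m * osc d x' ((y' - y + u) - m * (x' - x)) \<partial>lborel\<bar> \<le> C"
  shows "\<bar>gram d x y x' y'\<bar> \<le> 4 * C"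
proof -
  have C: "0 \<le> C" using H[of 0] d by linarith
  have "\<bar>gram d x y x' y'\<bar> \<le> 2 * (4*d) * (1/(2*d) * C)"
    unfolding gram_eq_iterated[OF d x]
  proof (rule abs_integral_le_bounded_support)
    show "(\<lambda>u. osc d x u * (\<integral>m. tent m * osc d x' ((y' - y + u) - m * (x' - x)) \<partial>lborel))
        \<in> borel_measurable borel"
      by measurable
    fix u
    show "\<bar>osc d x u * (\<integral>m. tent m * osc d x' ((y' - y + u) - m * (x' - x)) \<partial>lborel)\<bar> \<le> 1/(2*d) * C"
    proof (cases "\<bar>u\<bar> \<le> 4*d")
      case True
      then show ?thesis
        unfolding abs_mult by (intro mult_mono H abs_osc_le d) (use d in auto)
    next
      case False
      then show ?thesis using osc_eq_0[OF d x, of u] C d by simp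
    qed
    show "osc d x u * (\<integral>m. tent m * osc d x' ((y' - y + u) - m * (x' - x)) \<partial>lborel) = 0" if "4*d < \<bar>u\<bar>"
      using osc_eq_0[OF d x that] by simp
  qed (use d in simp)
  then show ?thesis using d by simp
qed

text \<open>
  No line of slope at most 3 passes near both points when their vertical separation greatly exceeds both
  the horizontal one and \<open>d\<close>, and the inner product vanishes. If the points are further apart than a
  multiple of \<open>d\<close> and this does not happen, the horizontal separation is comparable
  with \<open>r\<close> and the decay estimate applies.
\<close>

lemma gram_bounds:
  assumes d: "0 < d" and x: "\<bar>x\<bar> \<le> 1" "\<bar>x'\<bar> \<le> 1"
    and r: "r = max \<bar>x' - x\<bar> \<bar>y' - y\<bar>"
  shows "\<bar>gram d x y x' y'\<bar> \<le> 36 / d"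
    and "0 < r \<Longrightarrow> \<bar>gram d x y x' y'\<bar> \<le> 9216 * d / r^2"
proof -
  show *: "\<bar>gram d x y x' y'\<bar> \<le> 36 / d"
    using abs_gram_le[OF d x(1) tent_osc_integral_le[OF d x(2)]] by simp
  assume r0: "0 < r"
  show "\<bar>gram d x y x' y'\<bar> \<le> 9216 * d / r^2"
  proof (cases "r < 16*d")
    case True
    then have "r^2 \<le> (16*d)^2" using r0 by (intro power_mono) auto
    then have "36 / d \<le> 9216 * d / r^2"
      using d r0 by (simp add: field_simps power2_eq_square)
    then show ?thesis using * by linarith
  next
    case False
    show ?thesis
    proof (cases "3 * \<bar>x' - x\<bar> + 8*d < \<bar>y' - y\<bar>")
      case True
      have "\<bar>gram d x y x' y'\<bar> \<le> 4 * 0"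
      proof (rule abs_gram_le[OF d x(1)])
        fix u assume u: "\<bar>u\<bar> \<le> 4*d"
        have z: "tent m * osc d x' ((y' - y + u) - m * (x' - x)) = 0" for m
        proof (cases "3 < \<bar>m\<bar>")
          case False
          then have "\<bar>m * (x' - x)\<bar> \<le> 3 * \<bar>x' - x\<bar>" unfolding abs_mult by (intro mult_right_mono) auto
          then have "4*d < \<bar>(y' - y + u) - m * (x' - x)\<bar>" using True u by linarith
          then show ?thesis using osc_eq_0[OF d x(2)] by simp
        qed (simp add: tent_bounds)
        show "\<bar>\<integral>m. tent m * osc d x' ((y' - y + u) - m * (x' - x)) \<partial>lborel\<bar> \<le> 0"
          unfolding z by simp
      qed
      then show ?thesis using d r0 by simp
    next
      case F2: False
      then have "r \<le> 6 * \<bar>x' - x\<bar>" using False r by (auto simp: max_def split: if_splits)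
      then have ne: "x' - x \<noteq> 0" and "r^2 \<le> (6 * \<bar>x' - x\<bar>)^2"
        using r0 power_mono[of r "6 * \<bar>x' - x\<bar>" 2] by auto
      then have sq: "r^2 \<le> 36 * (x' - x)^2" by (simp add: power_mult_distrib)
      have "\<bar>gram d x y x' y'\<bar> \<le> 4 * (16 * d / (x' - x)^2)"
        by (rule abs_gram_le[OF d x(1) tent_osc_integral_decay[OF d x(2) ne]])
      also have "\<dots> \<le> 9216 * d / r^2"
      proof -
        have "64 * d * r^2 \<le> 64 * d * (36 * (x' - x)^2)" using sq d by (intro mult_left_mono) auto
        also have "\<dots> \<le> 9216 * d * (x'-x)^2" using d by simp
        finally show ?thesis using ne r0 by (simp add: field_simps)
      qed
      finally show ?thesis .
    qed
  qed
qed

text \<open>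
  The decay in a form that can be summed against counts of points in boxes.
\<close>

lemma gram_le_dyadic:
  fixes M :: nat
  assumes d: "0 < d" and x: "\<bar>x\<bar> \<le> 1" "\<bar>x'\<bar> \<le> 1"
    and r: "r = max \<bar>x' - x\<bar> \<bar>y' - y\<bar>" and M: "r \<le> 2^M * d"
  shows "\<bar>gram d x y x' y'\<bar> \<le> 40000 / d * (\<Sum>j\<le>M. of_bool (r \<le> 2^j * d) / 4^j)"
proof -
  define j where "j = (LEAST j. r \<le> 2^j * d)"
  have j: "r \<le> 2^j * d" "j \<le> M" unfolding j_def using M by (auto intro: LeastI Least_le)
  have "\<bar>gram d x y x' y'\<bar> \<le> 40000 / d * (1 / 4^j)"
  proof (cases j)
    case 0
    then show ?thesis using gram_bounds(1)[OF d x r] divide_right_mono[of 36 40000 d] d by simp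
  next
    case (Suc i)
    have "i < j" using Suc by simp
    then have i: "2^i * d < r" using not_less_Least[of i "\<lambda>j. r \<le> 2^j * d"] unfolding j_def by auto
    then have r0: "0 < r" using d by (smt (verit) zero_less_power mult_pos_pos)
    have "(2^i*d)^2 \<le> r^2" using i d by (intro power_mono) auto
    moreover have "((2::real)^i)^2 = 4^i" by (simp add: power2_eq_square flip: power_mult_distrib)
    ultimately have q: "4^i * d^2 \<le> r^2" by (simp add: power_mult_distrib)
    have "\<bar>gram d x y x' y'\<bar> \<le> 9216 * d / r^2" by (rule gram_bounds(2)[OF d x r r0])
    also have "\<dots> \<le> 9216 * d / (4^i * d^2)" using q d r0 by (intro divide_left_mono) auto
    also have "\<dots> \<le> 40000 / d * (1/4^j)" using d Suc by (simp add: field_simps power2_eq_square)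
    finally show ?thesis .
  qed
  also have "1 / 4^j = (\<Sum>i\<in>{j}. of_bool (r \<le> 2^i * d) / (4::real)^i)" using j by simp
  also have "\<dots> \<le> (\<Sum>i\<le>M. of_bool (r \<le> 2^i * d) / 4^i)" using j by (intro sum_mono2) auto
  finally show ?thesis using d by (simp add: mult_left_mono divide_right_mono)
qed

section \<open>The incidence bound for points and lines\<close>

text \<open>
  The number \<open>M\<close> bounds the number of dyadic scales between \<open>\<delta>\<close> and 1. The coordinates are
  functions on arbitrary index sets, so that the same statement serves both orientations of the axes.
\<close>

locale spaced_config =
  fixes P :: "'p set" and x y :: "'p \<Rightarrow> real" and T :: "'t set" and m b :: "'t \<Rightarrow> real"
    and \<delta> \<alpha> \<beta> A B :: real and M :: nat
  assumes finite_P: "finite P" and finite_T: "finite T"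
    and delta: "0 < \<delta>" "1 \<le> 2^M * \<delta>"
    and A: "0 < A" and B: "0 < B" and beta: "\<beta> \<le> 2"
    and coord: "p \<in> P \<Longrightarrow> 0 \<le> x p \<and> x p \<le> 1 \<and> 0 \<le> y p \<and> y p \<le> 1"
    and slope: "t \<in> T \<Longrightarrow> \<bar>m t\<bar> \<le> 1"
    and points_spaced: "\<lbrakk>p \<in> P; \<delta> \<le> r\<rbrakk> \<Longrightarrow>
       real (card {q\<in>P. \<bar>x q - x p\<bar> \<le> r \<and> \<bar>y q - y p\<bar> \<le> r}) \<le> A * (r/\<delta>) powr \<beta>"
    and lines_spaced: "\<delta> \<le> r \<Longrightarrow>
       real (card {t\<in>T. \<bar>m t - m0\<bar> \<le> r \<and> \<bar>b t - b0\<bar> \<le> r}) \<le> B * (r/\<delta>) powr \<alpha>"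
begin

definition line_density :: "real \<Rightarrow> real \<times> real \<Rightarrow> real" where
  "line_density d z = (\<Sum>t\<in>T. cell d (m t) (b t) z)"

definition osc_sum :: "real \<Rightarrow> real \<times> real \<Rightarrow> real" where
  "osc_sum d z = (\<Sum>p\<in>P. osc d (x p) (y p - fst z * x p - snd z))"

definition total_inc :: "real \<Rightarrow> real" where
  "total_inc d = (\<Sum>p\<in>P. \<Sum>t\<in>T. smooth_inc d (x p) (y p) (m t) (b t))"

lemma integrable_cell_osc:
  "0 < d \<Longrightarrow> integrable lborel (\<lambda>z. cell d m0 b0 z * osc d x0 (y0 - fst z * x0 - snd z))"
  by (rule integrable_cell_mult[where C = "1/(2*d)"]) (auto intro: abs_osc_le)

lemma total_inc_diff:
  assumes d: "0 < d"
  shows "integrable lborel (\<lambda>z. line_density d z * osc_sum d z)"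
    and "total_inc d - total_inc (2*d) = (\<integral>z. line_density d z * osc_sum d z \<partial>lborel)"
proof -
  have eq: "line_density d z * osc_sum d z
      = (\<Sum>p\<in>P. \<Sum>t\<in>T. cell d (m t) (b t) z * osc d (x p) (y p - fst z * x p - snd z))" for z
    unfolding line_density_def osc_sum_def by (subst sum_product, rule sum.swap)
  show "integrable lborel (\<lambda>z. line_density d z * osc_sum d z)"
    unfolding eq by (intro Bochner_Integration.integrable_sum integrable_cell_osc d)
  show "total_inc d - total_inc (2*d) = (\<integral>z. line_density d z * osc_sum d z \<partial>lborel)"
    unfolding eq total_inc_def
    by (simp add: integrable_cell_osc[OF d] Bochner_Integration.integral_sum Bochner_Integration.integrable_sum
        smooth_inc_diff[OF d, symmetric] sum_subtractf)
qed

lemma line_density_nonneg: "0 < d \<Longrightarrow> 0 \<le> line_density d z"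
  unfolding line_density_def by (intro sum_nonneg cell_nonneg)

lemma line_density_le:
  assumes d: "0 < d" "\<delta> \<le> d"
  shows "line_density d z \<le> B * (d/\<delta>) powr \<alpha> / (4*d^2)"
proof -
  let ?S = "{t\<in>T. \<bar>m t - fst z\<bar> \<le> d \<and> \<bar>b t - snd z\<bar> \<le> d}"
  have "line_density d z = (\<Sum>t\<in>?S. cell d (m t) (b t) z)"
    unfolding line_density_def
  proof (rule sum.mono_neutral_right[OF finite_T])
    show "\<forall>t\<in>T - ?S. cell d (m t) (b t) z = 0"
    proof
      fix t assume "t \<in> T - ?S"
      then have "d < \<bar>fst z - m t\<bar> \<or> d < \<bar>snd z - b t\<bar>"
        by (auto simp: abs_minus_commute not_le)
      then show "cell d (m t) (b t) z = 0" by (auto simp: cell_def box_avg_eq_0)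
    qed
  qed auto
  also have "\<dots> \<le> (\<Sum>t\<in>?S. 1/(4*d^2))" by (intro sum_mono cell_le d)
  also have "\<dots> = real (card ?S) / (4*d^2)" by simp
  also have "\<dots> \<le> B * (d/\<delta>) powr \<alpha> / (4*d^2)"
    by (intro divide_right_mono lines_spaced d) simp
  finally show ?thesis .
qed

text \<open>
  The square of the norm is at most the supremum times the total mass, and every line has mass 1.
\<close>

lemma line_density_L2:
  assumes d: "0 < d" "\<delta> \<le> d"
  shows "integrable lborel (\<lambda>z. (line_density d z)^2)"
    and "(\<integral>z. (line_density d z)^2 \<partial>lborel) \<le> B * (d/\<delta>) powr \<alpha> / (4*d^2) * card T"
proof -
  let ?C = "B * (d/\<delta>) powr \<alpha> / (4*d^2)"
  have "integrable lborel (\<lambda>z. cell d (m t) (b t) z * line_density d z)" for t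
    by (rule integrable_cell_mult[where C = ?C])
       (use d line_density_le[OF d] line_density_nonneg[OF d(1)] in \<open>auto simp: line_density_def abs_of_nonneg sum_nonneg cell_nonneg\<close>)
  then have "integrable lborel (\<lambda>z. \<Sum>t\<in>T. cell d (m t) (b t) z * line_density d z)"
    by (rule Bochner_Integration.integrable_sum)
  also have "(\<lambda>z. \<Sum>t\<in>T. cell d (m t) (b t) z * line_density d z) = (\<lambda>z. (line_density d z)^2)"
    by (simp add: line_density_def power2_eq_square sum_distrib_right fun_eq_iff)
  finally show I: "integrable lborel (\<lambda>z. (line_density d z)^2)" .
  have ic: "integrable lborel (\<lambda>z. ?C * line_density d z)"
    unfolding line_density_def by (intro integrable_mult_right Bochner_Integration.integrable_sum integral_cell d)
  have "(\<integral>z. (line_density d z)^2 \<partial>lborel) \<le> (\<integral>z. ?C * line_density d z \<partial>lborel)"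
  proof (rule integral_mono[OF I ic])
    show "(line_density d z)^2 \<le> ?C * line_density d z" for z
      unfolding power2_eq_square[of "line_density d z"]
      by (intro mult_right_mono line_density_le line_density_nonneg d)
  qed
  also have "\<dots> = ?C * card T"
    unfolding line_density_def
    by (simp add: Bochner_Integration.integral_sum integral_cell[OF d(1)])
  finally show "(\<integral>z. (line_density d z)^2 \<partial>lborel) \<le> ?C * card T" .
qed

text \<open>
  At distance \<open>2\<^sup>j d\<close> the number of points grows at most by the factor \<open>4\<^sup>j\<close>, because
  \<open>\<beta> \<le> 2\<close>, and the inner products shrink by \<open>4\<^sup>j\<close>. Each dyadic distance therefore contributes at
  most a constant times what the points within distance \<open>d\<close> may contribute, and there are at most
  \<open>M + 1\<close> such distances.
\<close>

lemma gram_row_sum: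
  assumes d: "0 < d" "\<delta> \<le> d" and p: "p \<in> P"
  shows "(\<Sum>q\<in>P. \<bar>gram d (x p) (y p) (x q) (y q)\<bar>)
     \<le> 40000 * (real M + 1) * A * (d/\<delta>) powr \<beta> / d"
proof -
  define r where "r q = max \<bar>x q - x p\<bar> \<bar>y q - y p\<bar>" for q
  have row: "\<bar>gram d (x p) (y p) (x q) (y q)\<bar> \<le> 40000 / d * (\<Sum>j\<le>M. of_bool (r q \<le> 2^j * d) / 4^j)"
    if q: "q \<in> P" for q
  proof (rule gram_le_dyadic[OF d(1)])
    show "\<bar>x p\<bar> \<le> 1" "\<bar>x q\<bar> \<le> 1" using coord[OF p] coord[OF q] by auto
    have "r q \<le> 1" using coord[OF p] coord[OF q] by (auto simp: r_def)
    also have "1 \<le> 2^M * \<delta>" by (rule delta)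
    also have "\<dots> \<le> 2^M * d" using d by simp
    finally show "r q \<le> 2^M * d" .
  qed (rule r_def)
  have level: "(\<Sum>q\<in>P. of_bool (r q \<le> 2^j * d) / 4^j) \<le> A * (d/\<delta>) powr \<beta>" for j :: nat
  proof -
    have j1: "(1::real) \<le> 2^j" by simp
    have rj: "\<delta> \<le> 2^j * d"
      using d j1 mult_mono[OF j1, of d d] by linarith
    have "(\<Sum>q\<in>P. of_bool (r q \<le> 2^j * d) / 4^j) = real (card {q\<in>P. r q \<le> 2^j * d}) / 4^j"
      using finite_P by (simp add: sum_divide_distrib[symmetric] sum_of_bool_eq Int_def)
    also have "{q\<in>P. r q \<le> 2^j * d} = {q\<in>P. \<bar>x q - x p\<bar> \<le> 2^j * d \<and> \<bar>y q - y p\<bar> \<le> 2^j * d}"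
      by (auto simp: r_def)
    also have "real (card \<dots>) / 4^j \<le> A * (2^j * d/\<delta>) powr \<beta> / 4^j"
      by (intro divide_right_mono points_spaced[OF p rj]) simp
    also have "(2^j * d/\<delta>) powr \<beta> = (2^j) powr \<beta> * (d/\<delta>) powr \<beta>"
      using d delta by (simp flip: powr_mult)
    also have "A * ((2^j) powr \<beta> * (d/\<delta>) powr \<beta>) / 4^j \<le> A * (4^j * (d/\<delta>) powr \<beta>) / 4^j"
    proof -
      have "((2::real)^j) powr \<beta> \<le> (2^j) powr 2" using beta j1 by (intro powr_mono) auto
      also have "\<dots> = (4::real)^j" by (simp add: power2_eq_square flip: power_mult_distrib)
      finally show ?thesis using A by (intro divide_right_mono mult_left_mono mult_right_mono) auto
    qed
    finally show ?thesis by simp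
  qed
  have "(\<Sum>q\<in>P. \<bar>gram d (x p) (y p) (x q) (y q)\<bar>)
      \<le> (\<Sum>q\<in>P. 40000 / d * (\<Sum>j\<le>M. of_bool (r q \<le> 2^j * d) / 4^j))"
    by (intro sum_mono row)
  also have "\<dots> = 40000 / d * (\<Sum>j\<le>M. \<Sum>q\<in>P. of_bool (r q \<le> 2^j * d) / 4^j)"
    by (subst sum.swap) (simp add: sum_distrib_left)
  also have "\<dots> \<le> 40000 / d * (\<Sum>j\<le>M. A * (d/\<delta>) powr \<beta>)"
    using d by (intro mult_left_mono sum_mono level) auto
  finally show ?thesis by (simp add: algebra_simps)
qed

lemma osc_sum_L2:
  assumes d: "0 < d" "\<delta> \<le> d"
  shows "integrable lborel (\<lambda>z. tent (fst z) * (osc_sum d z)^2)"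
    and "(\<integral>z. tent (fst z) * (osc_sum d z)^2 \<partial>lborel)
       \<le> 40000 * (real M + 1) * A * (d/\<delta>) powr \<beta> / d * card P"
proof -
  let ?g = "\<lambda>p q z. tent (fst z) * osc d (x p) (y p - fst z * x p - snd z) * osc d (x q) (y q - fst z * x q - snd z)"
  have eq: "tent (fst z) * (osc_sum d z)^2 = (\<Sum>p\<in>P. \<Sum>q\<in>P. ?g p q z)" for z
    unfolding osc_sum_def power2_eq_square sum_product by (simp add: sum_distrib_left mult.assoc)
  have ig: "integrable lborel (?g p q)" if "p \<in> P" for p q
    by (rule integrable_gram[OF d(1)]) (use coord[OF that] in auto)
  show "integrable lborel (\<lambda>z. tent (fst z) * (osc_sum d z)^2)"
    unfolding eq by (intro Bochner_Integration.integrable_sum ig)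
  have "(\<integral>z. tent (fst z) * (osc_sum d z)^2 \<partial>lborel) = (\<Sum>p\<in>P. \<Sum>q\<in>P. gram d (x p) (y p) (x q) (y q))"
    unfolding eq by (simp add: Bochner_Integration.integral_sum Bochner_Integration.integrable_sum ig gram_def)
  also have "\<dots> \<le> (\<Sum>p\<in>P. \<Sum>q\<in>P. \<bar>gram d (x p) (y p) (x q) (y q)\<bar>)"
    by (intro sum_mono) simp
  also have "\<dots> \<le> (\<Sum>p\<in>P. 40000 * (real M + 1) * A * (d/\<delta>) powr \<beta> / d)"
    by (intro sum_mono gram_row_sum d)
  finally show "(\<integral>z. tent (fst z) * (osc_sum d z)^2 \<partial>lborel)
       \<le> 40000 * (real M + 1) * A * (d/\<delta>) powr \<beta> / d * card P" by (simp add: mult.commute)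
qed

text \<open>
  Cauchy-Schwarz for \<open>\<integral> N F\<close>, with the weight \<open>tent\<close> on the side of \<open>F\<close>. It is carried out through
  the non-negative quadratic \<open>\<integral> N\<^sup>2 + 2 c N F + c\<^sup>2 tent F\<^sup>2\<close> in \<open>c\<close>: below,
  \<open>U\<close> and \<open>V\<close> are upper bounds for the two squared norms and \<open>W\<close> is the integral.
\<close>

lemma scale_step:
  assumes d: "0 < d" "\<delta> \<le> d" "d \<le> 1"
  shows "\<bar>total_inc d - total_inc (2*d)\<bar>
     \<le> 100 * (real M + 1) * sqrt (card P * card T * (A * B)) * (d/\<delta>) powr ((\<alpha>+\<beta>)/2) * d powr (-3/2)"
proof (cases "P = {}")
  case True
  show ?thesis unfolding total_inc_def unfolding True by simp
next
  case False
  define U where "U = B * (d/\<delta>) powr \<alpha> / (4*d^2) * card T"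
  define V where "V = 40000 * (real M + 1) * A * (d/\<delta>) powr \<beta> / d * card P"
  define W where "W = total_inc d - total_inc (2*d)"
  have cP: "0 < card P" using False finite_P by (simp add: card_gt_0_iff)
  have V: "0 < V" unfolding V_def using A d delta cP by simp
  have pos: "0 \<le> (line_density d z)^2 + 2*c*(line_density d z * osc_sum d z) + c^2*(tent (fst z) * (osc_sum d z)^2)"
    for z c
  proof (cases "\<bar>fst z\<bar> \<le> 2")
    case True
    have "0 \<le> (line_density d z + c * osc_sum d z)^2" by simp
    also have "\<dots> = (line_density d z)^2 + 2*c*(line_density d z * osc_sum d z) + c^2*(1 * (osc_sum d z)^2)"
      by (simp add: power2_sum power_mult_distrib)
    also have "\<dots> \<le> (line_density d z)^2 + 2*c*(line_density d z * osc_sum d z) + c^2*(tent (fst z) * (osc_sum d z)^2)"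
      by (intro add_left_mono mult_left_mono mult_right_mono tent_bounds(4)[OF True]) auto
    finally show ?thesis .
  next
    case F: False
    have "line_density d z = 0"
      unfolding line_density_def
    proof (rule sum.neutral, rule ballI)
      fix t assume "t \<in> T"
      then have "d < \<bar>fst z - m t\<bar>" using slope[of t] F d by linarith
      then show "cell d (m t) (b t) z = 0" by (simp add: cell_def box_avg_eq_0)
    qed
    then show ?thesis by (simp add: tent_bounds)
  qed
  have quad: "0 \<le> U + 2*c*W + c^2*V" for c
  proof -
    have "0 \<le> (\<integral>z. (line_density d z)^2 + 2*c*(line_density d z * osc_sum d z) + c^2*(tent (fst z) * (osc_sum d z)^2) \<partial>lborel)"
      by (rule Bochner_Integration.integral_nonneg) (rule pos)
    also have "\<dots> = (\<integral>z. (line_density d z)^2 \<partial>lborel) + 2*c*W + c^2*(\<integral>z. tent (fst z) * (osc_sum d z)^2 \<partial>lborel)"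
      unfolding W_def total_inc_diff(2)[OF d(1)]
      using total_inc_diff(1)[OF d(1)] line_density_L2(1)[OF d(1,2)] osc_sum_L2(1)[OF d(1,2)] by simp
    also have "\<dots> \<le> U + 2*c*W + c^2*V"
      unfolding U_def V_def
      by (intro add_mono mult_left_mono line_density_L2 osc_sum_L2 d order_refl) auto
    finally show ?thesis .
  qed
  \<comment> \<open>The quadratic is smallest at \<open>c = -W/V\<close>.\<close>
  have "0 \<le> U + 2*(-W/V)*W + (-W/V)^2*V" by (rule quad)
  also have "\<dots> = (U*V - W^2)/V" using V by (simp add: field_simps power2_eq_square)
  finally have "W^2 \<le> U * V" using V by (simp add: zero_le_divide_iff)
  also have "U * V = 10000 * (real M + 1) * (card P * card T * (A * B)) * ((d/\<delta>) powr ((\<alpha>+\<beta>)/2) * d powr (-3/2))^2"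
  proof -
    have e1: "((d/\<delta>) powr ((\<alpha>+\<beta>)/2))^2 = (d/\<delta>) powr \<alpha> * (d/\<delta>) powr \<beta>"
      by (simp add: power2_eq_square flip: powr_add)
    have e2: "(d powr (-3/2))^2 = 1/d^3"
      using d by (simp add: power2_eq_square powr_minus_divide powr_numeral flip: powr_add)
    show ?thesis
      unfolding U_def V_def power_mult_distrib e1 e2 using d
      by (simp add: field_simps power2_eq_square power3_eq_cube)
  qed
  also have "\<dots> \<le> (100 * (real M + 1) * sqrt (card P * card T * (A * B)) * ((d/\<delta>) powr ((\<alpha>+\<beta>)/2) * d powr (-3/2)))^2"
  proof -
    have "real M + 1 \<le> (real M + 1)^2" by (simp add: power2_eq_square algebra_simps)
    then show ?thesis
      unfolding power_mult_distrib[of _ "_ * _"] power_mult_distrib[of "100 * _"] power_mult_distrib[of 100]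
      using A B by (intro mult_right_mono mult_mono) auto
  qed
  finally have "\<bar>W\<bar> \<le> 100 * (real M + 1) * sqrt (card P * card T * (A * B)) * ((d/\<delta>) powr ((\<alpha>+\<beta>)/2) * d powr (-3/2))"
    by (rule abs_le_square_iff[THEN iffD2, THEN order_trans]) (use A B in simp)
  then show ?thesis unfolding W_def by (simp add: mult.assoc)
qed

text \<open>
  The scale \<open>\<rho>\<close> is chosen so that \<open>scale_step\<close> at \<open>d = \<rho>\<close> gives, up to a factor
  \<open>100 (M + 1)\<close>, the trivial bound \<open>|P| |T| / \<rho>\<close>; since \<open>\<alpha> + \<beta> \<ge> 3\<close>, all smaller scales contribute at most this much
  each. The cardinality bounds say that \<open>\<rho> \<le> 1\<close>, so that only \<open>M\<close> scales occur. If
  \<open>\<rho> \<le> 8 \<delta>\<close>, already counting all pairs is good enough.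
\<close>

lemma incidence_bound:
  assumes S: "3 \<le> \<alpha> + \<beta>" and c: "c = 1 / (\<alpha> + \<beta> - 1)"
    and cardP: "real (card P) \<le> A * \<delta> powr (-\<beta>)" and cardT: "real (card T) \<le> B * \<delta> powr (-\<alpha>)"
  shows "real (card {(p,t). p \<in> P \<and> t \<in> T \<and> \<bar>y p - m t * x p - b t\<bar> \<le> 4 * \<delta>})
     \<le> 110000 * (real M + 1)^2 * \<delta> powr (-c) * (A * B) powr c * (real (card P) * real (card T)) powr (1 - c)"
    (is "real (card ?I) \<le> _")
proof -
  define X where "X = real (card P) * real (card T)"
  define k where "k = A * B"
  define S where "S = \<alpha> + \<beta>"
  define \<rho> where "\<rho> = X powr c * k powr (-c) * \<delta> powr (S * c)"
  have k: "0 < k" unfolding k_def using A B by simp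
  have S3: "3 \<le> S" and cS: "c * (S - 1) = 1" "c > 0" using S c by (simp_all add: S_def)
  have "c * S - c * 1 = 1" using cS(1) unfolding right_diff_distrib .
  then have Sc: "S * c = 1 + c" by (subst mult.commute) linarith
  have sub: "?I \<subseteq> P \<times> T" by auto
  have fin: "finite (P \<times> T)" using finite_P finite_T by simp
  have triv: "real (card ?I) \<le> X"
    unfolding X_def of_nat_mult[symmetric] of_nat_le_iff
    using card_mono[OF fin sub] unfolding card_cartesian_product .
  show ?thesis
  proof (cases "X = 0")
    case True
    have "real (card ?I) \<le> 0" using triv unfolding True .
    also have "0 \<le> 110000 * (real M + 1)^2 * \<delta> powr (-c) * (A * B) powr c * (real (card P) * real (card T)) powr (1 - c)"
      by simp
    finally show ?thesis .
  next
    case False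
    moreover have "0 \<le> X" unfolding X_def by simp
    ultimately have X: "0 < X" by linarith
    have \<rho>: "0 < \<rho>" unfolding \<rho>_def using X k delta by simp
    have ln_\<rho>: "ln \<rho> = c * ln X - c * ln k + (1 + c) * ln \<delta>"
      unfolding \<rho>_def Sc using X k delta by (simp add: ln_mult ln_powr algebra_simps)
    have main_term: "\<delta> * (X / \<rho>) = \<delta> powr (-c) * k powr c * X powr (1 - c)"
    proof -
      have "ln (\<delta> * (X / \<rho>)) = ln (\<delta> powr (-c) * k powr c * X powr (1 - c))"
        using X k delta \<rho> by (simp add: ln_mult ln_div ln_powr ln_\<rho> algebra_simps)
      then show ?thesis using X k delta \<rho> by (subst (asm) ln_inj_iff) auto
    qed
    have balance: "sqrt (X * k) * \<delta> powr (- S/2) * \<rho> powr ((S - 3)/2) = X / \<rho>"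
    proof -
      have c2: "(1 + c) * (S - 1) = S" unfolding distrib_right cS(1) by simp
      have "(S - 1) * ln \<rho> = c * (S - 1) * ln X - c * (S - 1) * ln k + (1 + c) * (S - 1) * ln \<delta>"
        unfolding ln_\<rho> by (simp add: algebra_simps)
      then have "(S - 1) * ln \<rho> = ln X - ln k + S * ln \<delta>" unfolding cS(1) c2 by simp
      then have e: "S * ln \<rho> = ln \<rho> + ln X - ln k + S * ln \<delta>" by (simp add: left_diff_distrib)
      have "ln (sqrt (X * k) * \<delta> powr (- S/2) * \<rho> powr ((S - 3)/2)) = ln (X / \<rho>)"
        using X k delta \<rho> e by (simp add: ln_mult ln_div ln_powr ln_sqrt field_simps)
      then show ?thesis using X k delta \<rho> by (subst (asm) ln_inj_iff) auto
    qed
    have "real (card ?I) \<le> 110000 * (real M + 1)^2 * (\<delta> * (X / \<rho>))"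
    proof (cases "\<rho> \<le> 8 * \<delta>")
      case True
      have "X * \<rho> \<le> X * (8 * \<delta>)" using True X by simp
      then have "X \<le> 8 * (\<delta> * (X / \<rho>))" using \<rho> by (simp add: field_simps)
      also have "\<dots> \<le> 110000 * (real M + 1)^2 * (\<delta> * (X / \<rho>))"
      proof (rule mult_right_mono)
        have "1 \<le> (real M + 1)^2" by simp
        then show "8 \<le> 110000 * (real M + 1)^2" by linarith
      qed (use X \<rho> delta in simp)
      finally show ?thesis using triv by linarith
    next
      case F: False
      have "X \<le> (A * \<delta> powr (-\<beta>)) * (B * \<delta> powr (-\<alpha>))"
        unfolding X_def using cardP cardT by (intro mult_mono) auto
      also have "\<dots> = k * \<delta> powr (-S)" by (simp add: k_def S_def powr_add[symmetric] algebra_simps)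
      finally have "ln X \<le> ln (k * \<delta> powr (-S))" using X k delta by simp
      then have "ln X \<le> ln k - S * ln \<delta>" using k delta by (simp add: ln_mult ln_powr)
      then have "c * ln X \<le> c * (ln k - S * ln \<delta>)" using cS by simp
      also have "\<dots> = c * ln k - S * c * ln \<delta>" by (simp add: algebra_simps)
      finally have "ln \<rho> \<le> 0" unfolding ln_\<rho> Sc by simp
      then have \<rho>1: "\<rho> \<le> 1" using \<rho> by simp
      define n where "n = (LEAST n. \<rho> \<le> 2^n * (8 * \<delta>))"
      define dd where "dd j = 2^j * (8 * \<delta>)" for j :: nat
      have dd_pos: "0 < dd j" "8 * \<delta> \<le> dd j" for j
        unfolding dd_def using delta by simp_all
      have "1 \<le> dd M" using delta by (simp add: dd_def)
      then have ex: "\<rho> \<le> 2^M * (8 * \<delta>)" using \<rho>1 by (simp add: dd_def)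
      have n: "\<rho> \<le> dd n" "n \<le> M"
        unfolding dd_def n_def using ex by (auto intro: LeastI Least_le)
      have below: "dd j < \<rho>" if "j < n" for j
        using not_less_Least[of j "\<lambda>n. \<rho> \<le> 2^n * (8 * \<delta>)"] that by (simp add: n_def dd_def)
      have step: "total_inc (dd j) - total_inc (dd (Suc j)) \<le> 100 * (real M + 1) * (X / \<rho>)" if "j < n" for j
      proof -
        have "\<bar>total_inc (dd j) - total_inc (2 * dd j)\<bar>
            \<le> 100 * (real M + 1) * sqrt (X * k) * (dd j/\<delta>) powr (S/2) * dd j powr (-3/2)"
          using scale_step[of "dd j"] dd_pos[of j] below[OF that] \<rho>1 delta by (simp add: X_def k_def S_def)
        also have "\<dots> = 100 * (real M + 1) * (sqrt (X * k) * \<delta> powr (-S/2) * dd j powr ((S-3)/2))"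
          using delta dd_pos[of j] 
          by (simp add: powr_divide powr_minus_divide diff_divide_distrib powr_diff)
        also have "\<dots> \<le> 100 * (real M + 1) * (sqrt (X * k) * \<delta> powr (-S/2) * \<rho> powr ((S-3)/2))"
          using below[OF that] dd_pos[of j] S3 X k by (intro mult_left_mono powr_mono2) auto
        finally show ?thesis unfolding balance by (simp add: dd_def mult.assoc)
      qed
      have "total_inc (dd 0) - total_inc (dd n) = (\<Sum>j<n. total_inc (dd j) - total_inc (dd (Suc j)))"
        by (rule sum_lessThan_telescope'[symmetric])
      also have "\<dots> \<le> (\<Sum>j<n. 100 * (real M + 1) * (X / \<rho>))" by (intro sum_mono step) simp
      also have "\<dots> = real n * (100 * (real M + 1) * (X / \<rho>))" by simp
      also have "\<dots> \<le> real M * (100 * (real M + 1) * (X / \<rho>))"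
        using n(2) X \<rho> by (intro mult_right_mono) auto
      finally have A1: "total_inc (dd 0) \<le> total_inc (dd n) + real M * (100 * (real M + 1) * (X / \<rho>))" by simp
      have "total_inc (dd n) \<le> (\<Sum>p\<in>P. \<Sum>t\<in>T. 1 / (2 * dd n))"
        unfolding total_inc_def by (intro sum_mono smooth_inc_upper dd_pos)
      also have "\<dots> = X / (2 * dd n)" by (simp add: X_def)
      also have "\<dots> \<le> X / \<rho>" using n(1) \<rho> X by (intro divide_left_mono) auto
      finally have A2: "total_inc (dd n) \<le> X / \<rho>" .
      have "real (card ?I) * (1 / (128 * (8 * \<delta>))) \<le> total_inc (dd 0)"
      proof -
        have nn: "0 \<le> smooth_inc (8 * \<delta>) (x p) (y p) (m t) (b t)" for p t
          unfolding smooth_inc_def using delta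
          by (intro Bochner_Integration.integral_nonneg mult_nonneg_nonneg cell_nonneg box_avg_nonneg) auto
        have "real (card ?I) * (1 / (128 * (8 * \<delta>))) = (\<Sum>(p,t)\<in>?I. 1 / (128 * (8 * \<delta>)))"
          by (simp add: case_prod_beta')
        also have "\<dots> \<le> (\<Sum>(p,t)\<in>?I. smooth_inc (8 * \<delta>) (x p) (y p) (m t) (b t))"
        proof (rule sum_mono, clarify)
          fix p t assume "p \<in> P" "\<bar>y p - m t * x p - b t\<bar> \<le> 4 * \<delta>"
          then show "1 / (128 * (8 * \<delta>)) \<le> smooth_inc (8 * \<delta>) (x p) (y p) (m t) (b t)"
            using coord delta by (intro smooth_inc_lower) auto
        qed
        also have "\<dots> \<le> (\<Sum>(p,t)\<in>P\<times>T. smooth_inc (8 * \<delta>) (x p) (y p) (m t) (b t))"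
          using nn by (intro sum_mono2[OF fin sub]) auto
        also have "\<dots> = total_inc (dd 0)" by (simp add: total_inc_def dd_def sum.cartesian_product)
        finally show ?thesis .
      qed
      also have "total_inc (dd 0) \<le> X / \<rho> + real M * (100 * (real M + 1) * (X / \<rho>))" using A1 A2 by linarith
      finally have "real (card ?I) \<le> 1024 * \<delta> * (X / \<rho> + real M * (100 * (real M + 1) * (X / \<rho>)))"
        using delta by (simp add: field_simps)
      also have "\<dots> = (1024 + 102400 * real M * (real M + 1)) * (\<delta> * (X / \<rho>))" by (simp add: algebra_simps)
      also have "\<dots> \<le> 110000 * (real M + 1)^2 * (\<delta> * (X / \<rho>))"
        using X \<rho> delta by (intro mult_right_mono) (auto simp: power2_eq_square algebra_simps)
      finally show ?thesis .
    qed
    then show ?thesis unfolding main_term by (simp add: X_def k_def mult.assoc)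
  qed
qed

end

section \<open>Balls and tubes as points and lines\<close>

lemma index_pair_2:
  fixes i j :: 2
  assumes "i \<noteq> j"
  shows "k = i \<or> k = j"
  using exhaust_2[of i] exhaust_2[of j] exhaust_2[of k] assms by auto

lemma UNIV_pair_2:
  fixes i j :: 2
  assumes "i \<noteq> j"
  shows "(UNIV :: 2 set) = {i, j}"
  using index_pair_2[OF assms] by auto

lemma inner_pair:
  fixes a b :: "real^2"
  assumes "i \<noteq> j"
  shows "a \<bullet> b = a$i * b$i + a$j * b$j"
  unfolding inner_vec_def UNIV_pair_2[OF assms] using assms by simp

lemma norm_pair:
  fixes a :: "real^2"
  assumes "i \<noteq> j"
  shows "norm a = sqrt ((a$i)^2 + (a$j)^2)"
  unfolding norm_eq_sqrt_inner inner_pair[OF assms] by (simp add: power2_eq_square)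

lemma mem_unit_square: "z \<in> unit_square \<longleftrightarrow> (\<forall>k. 0 \<le> z$k \<and> z$k \<le> 1)"
proof -
  have "(One :: real^2) $ k = 1" for k
    using inner_sum_left_Basis[of "axis k 1 :: real^2" "\<lambda>_. 1"]
    by (simp add: cart_eq_inner_axis axis_in_Basis_iff)
  then show ?thesis unfolding unit_square_def by (simp add: mem_box_cart)
qed

lemma unit_square_near_centre:
  assumes "z \<in> unit_square"
  shows "norm (z - (\<chi> k. 1/2)) \<le> 1"
proof -
  have sq: "(z$k - 1/2)^2 \<le> 1/4" for k
  proof -
    have "\<bar>z$k - 1/2\<bar> \<le> 1/2" using assms[unfolded mem_unit_square, rule_format, of k] by linarith
    then have "\<bar>z$k - 1/2\<bar>^2 \<le> (1/2)^2" by (intro power_mono) auto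
    then show ?thesis by (simp add: power2_eq_square)
  qed
  have "norm (z - (\<chi> k. 1/2)) = sqrt ((z$1 - 1/2)^2 + (z$2 - 1/2)^2)"
    by (subst norm_pair[of 1 2]) auto
  also have "\<dots> \<le> sqrt 1" using sq[of 1] sq[of 2] by (intro real_sqrt_le_mono) linarith
  finally show ?thesis by simp
qed

text \<open>
  Used to absorb the dilations that pass between boxes, balls and rectangles into absolute constants.
\<close>

lemma powr_scaled_le:
  fixes a s e :: real
  assumes "1 \<le> a" "0 \<le> s" "e \<le> 2"
  shows "(a * s) powr e \<le> a^2 * s powr e"
proof -
  have "a powr e \<le> a powr 2" using assms by (intro powr_mono) auto
  then have "a powr e * s powr e \<le> a^2 * s powr e" using assms by (intro mult_right_mono) auto
  then show ?thesis using assms by (simp add: powr_mult)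
qed

lemma ball_set_mono:
  assumes "ball_set \<delta> \<beta> K P" "\<beta> \<le> \<beta>'" "0 < \<delta>" "0 \<le> K"
  shows "ball_set \<delta> \<beta>' K P"
proof -
  have "K * (w/\<delta>) powr \<beta> \<le> K * (w/\<delta>) powr \<beta>'" if "\<delta> \<le> w" for w
    using assms that by (intro mult_left_mono powr_mono) auto
  then show ?thesis using assms(1) unfolding ball_set_def by (meson order_trans)
qed

lemma tube_set_mono:
  assumes "tube_set \<delta> \<alpha> K T" "\<alpha> \<le> \<alpha>'" "0 < \<delta>" "0 \<le> K"
  shows "tube_set \<delta> \<alpha>' K T"
proof -
  have "K * (w/\<delta>) powr \<alpha> \<le> K * (w/\<delta>) powr \<alpha>'" if "\<delta> \<le> w" for w
    using assms that by (intro mult_left_mono powr_mono) auto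
  then show ?thesis using assms(1) unfolding tube_set_def by (meson order_trans)
qed

text \<open>
  The unit square lies in a single ball of radius 1.
\<close>

lemma ball_set_card:
  assumes "ball_set \<delta> \<beta> K P" "\<delta> \<le> 1"
  shows "finite P" "real (card P) \<le> K * (1/\<delta>) powr \<beta>"
proof -
  have "is_ball 1 (cball (\<chi> k. 1/2) 1)" unfolding is_ball_def by blast
  moreover have "{p\<in>P. p \<subseteq> cball (\<chi> k. 1/2) 1} = P"
  proof -
    have "p \<subseteq> cball (\<chi> k. 1/2) 1" if "p \<in> P" for p
    proof
      fix z assume "z \<in> p"
      then have "z \<in> unit_square" using assms(1) that unfolding ball_set_def by blast
      then show "z \<in> cball (\<chi> k. 1/2) 1"
        using unit_square_near_centre[of z] by (simp add: dist_norm norm_minus_commute)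
    qed
    then show ?thesis by blast
  qed
  ultimately show "finite P" "real (card P) \<le> K * (1/\<delta>) powr \<beta>"
    using assms(1)[unfolded ball_set_def, THEN conjunct2, rule_format, of 1 "cball (\<chi> k. 1/2) 1"] assms(2) by auto
qed

text \<open>
  Balls whose centres lie in a box of half-width \<open>r\<close> are contained in a ball of radius \<open>3 r\<close>. When this
  radius exceeds 1, the count of all balls is used instead.
\<close>

lemma ball_set_count:
  assumes P: "ball_set \<delta> \<beta> K P" and d: "0 < \<delta>" "\<delta> \<le> 1" and r: "\<delta> \<le> r" and "\<beta> \<le> 2" "0 \<le> \<beta>" "0 \<le> K"
    and ij: "i \<noteq> j" and z: "\<And>p. p \<in> P \<Longrightarrow> p = cball (z p) \<delta>"
  shows "real (card {q\<in>P. \<bar>z q $ i - a $ i\<bar> \<le> r \<and> \<bar>z q $ j - a $ j\<bar> \<le> r}) \<le> 9 * K * (r/\<delta>) powr \<beta>"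
    (is "real (card ?S) \<le> _")
proof -
  have "real (card ?S) \<le> K * (3 * (r/\<delta>)) powr \<beta>"
  proof (cases "3 * r \<le> 1")
    case True
    have sub: "?S \<subseteq> {q\<in>P. q \<subseteq> cball a (3*r)}"
    proof clarify
      fix q w assume q: "q \<in> P" "\<bar>z q $ i - a $ i\<bar> \<le> r" "\<bar>z q $ j - a $ j\<bar> \<le> r" and w: "w \<in> q"
      have "norm (z q - a) \<le> \<bar>(z q - a)$i\<bar> + \<bar>(z q - a)$j\<bar>"
        using norm_le_l1_cart[of "z q - a"] unfolding UNIV_pair_2[OF ij] using ij by simp
      then have "dist (z q) a \<le> 2 * r" using q by (simp add: dist_norm)
      moreover have "dist (z q) w \<le> \<delta>" using w z[OF q(1)] by auto
      ultimately have "dist a w \<le> 3 * r"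
        using dist_triangle[of a w "z q"] r by (simp add: dist_commute)
      then show "w \<in> cball a (3*r)" by simp
    qed
    have "finite {q\<in>P. q \<subseteq> cball a (3*r)}"
      and B: "real (card {q\<in>P. q \<subseteq> cball a (3*r)}) \<le> K * (3*r/\<delta>) powr \<beta>"
      using P[unfolded ball_set_def, THEN conjunct2, rule_format, of "3*r" "cball a (3*r)"] True d r
      unfolding is_ball_def by auto
    then have "real (card ?S) \<le> real (card {q\<in>P. q \<subseteq> cball a (3*r)})"
      using sub by (simp add: card_mono)
    then show ?thesis using B by simp
  next
    case False
    have "real (card ?S) \<le> real (card P)" using ball_set_card(1)[OF P d(2)] by (simp add: card_mono)
    also have "\<dots> \<le> K * (1/\<delta>) powr \<beta>" by (rule ball_set_card(2)[OF P d(2)])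
    also have "\<dots> \<le> K * (3 * (r/\<delta>)) powr \<beta>"
      using False d assms by (intro mult_left_mono powr_mono2) (auto simp: field_simps)
    finally show ?thesis .
  qed
  also have "\<dots> \<le> K * (3^2 * (r/\<delta>) powr \<beta>)"
    using assms by (intro mult_left_mono powr_scaled_le) auto
  finally show ?thesis by simp
qed

text \<open>
  The rectangle has one side along the line. Length 2 suffices because the unit square lies within
  distance 1 of its centre.
\<close>

lemma strip_in_rectangle:
  fixes i j :: 2
  assumes ij: "i \<noteq> j" and w: "0 \<le> w"
  shows "\<exists>R. is_rectangle w 2 R \<and> {z\<in>unit_square. \<bar>z$j - m * z$i - b\<bar> \<le> w/2} \<subseteq> R"
proof -
  define L where "L = sqrt (1 + m^2)"
  have L2: "L * L = 1 + m*m" unfolding L_def by (simp add: power2_eq_square)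
  have L1: "1 \<le> L" unfolding L_def by simp
  define u v :: "real^2" where "u = (\<chi> k. if k = i then -m/L else 1/L)"
    and "v = (\<chi> k. if k = i then 1/L else m/L)"
  have comp [simp]: "u$i = -m/L" "u$j = 1/L" "v$i = 1/L" "v$j = m/L"
    using ij by (auto simp: u_def v_def)
  have ne: "1 + m*m \<noteq> 0" using zero_le_square[of m] by linarith
  have unit: "(1 + m*m)/(L*L) = 1" unfolding L2[symmetric] using L1 by simp
  have nu: "norm u = 1" "norm v = 1"
    unfolding norm_pair[OF ij] comp
    using unit ne by (simp_all add: power2_eq_square add_divide_distrib[symmetric] add.commute)
  have uv: "u \<bullet> v = 0" unfolding inner_pair[OF ij] comp by simp
  define c :: "real^2" where "c = (\<chi> k. 1/2)"
  define x where "x = (b/L - w/2) *\<^sub>R u + (c \<bullet> v - 1) *\<^sub>R v"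
  define R where "R = {x + s *\<^sub>R u + t *\<^sub>R v | s t. 0 \<le> s \<and> s \<le> w \<and> 0 \<le> t \<and> t \<le> 2}"
  have "is_rectangle w 2 R" unfolding is_rectangle_def R_def using nu uv by blast
  moreover have "z \<in> R" if z: "z \<in> unit_square" and s: "\<bar>z$j - m * z$i - b\<bar> \<le> w/2" for z
  proof -
    have "z = (z \<bullet> u) *\<^sub>R u + (z \<bullet> v) *\<^sub>R v"
    proof (rule vec_eq_iff[THEN iffD2], rule allI)
      fix k
      have "((z \<bullet> u) *\<^sub>R u + (z \<bullet> v) *\<^sub>R v)$i = z$i * ((1 + m*m)/(L*L))"
        "((z \<bullet> u) *\<^sub>R u + (z \<bullet> v) *\<^sub>R v)$j = z$j * ((1 + m*m)/(L*L))"
        unfolding inner_pair[OF ij] by (simp_all add: add_divide_distrib diff_divide_distrib algebra_simps)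
      then have "z$i = ((z \<bullet> u) *\<^sub>R u + (z \<bullet> v) *\<^sub>R v)$i" "z$j = ((z \<bullet> u) *\<^sub>R u + (z \<bullet> v) *\<^sub>R v)$j"
        unfolding unit by simp_all
      then show "z$k = ((z \<bullet> u) *\<^sub>R u + (z \<bullet> v) *\<^sub>R v)$k" using index_pair_2[OF ij, of k] by auto
    qed
    then have zeq: "z = x + (z \<bullet> u - b/L + w/2) *\<^sub>R u + (z \<bullet> v - c \<bullet> v + 1) *\<^sub>R v"
      unfolding x_def by (simp add: algebra_simps)
    have "\<bar>z \<bullet> u - b/L\<bar> \<le> w/2"
    proof -
      have "z \<bullet> u - b/L = (z$j - m * z$i - b)/L"
        unfolding inner_pair[OF ij] by (simp add: diff_divide_distrib)
      then have "\<bar>z \<bullet> u - b/L\<bar> = \<bar>z$j - m * z$i - b\<bar>/L" using L1 by simp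
      also have "\<dots> \<le> (w/2)/1" using s L1 w by (intro frac_le) auto
      finally show ?thesis by simp
    qed
    then have su: "0 \<le> z \<bullet> u - b/L + w/2" "z \<bullet> u - b/L + w/2 \<le> w" by linarith+
    have "\<bar>z \<bullet> v - c \<bullet> v\<bar> \<le> 1"
      using Cauchy_Schwarz_ineq2[of "z - c" v] unit_square_near_centre[OF z] nu(2)
      by (simp add: inner_diff_left c_def)
    then have "0 \<le> z \<bullet> v - c \<bullet> v + 1" "z \<bullet> v - c \<bullet> v + 1 \<le> 2" by linarith+
    then show ?thesis unfolding R_def using su zeq by blast
  qed
  ultimately show ?thesis by blast
qed

lemma tube_set_card:
  assumes T: "tube_set \<delta> \<alpha> K T" and "\<delta> \<le> 1"
  shows "finite T" "real (card T) \<le> K * (1/\<delta>) powr \<alpha>"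
proof -
  have "(1::2) \<noteq> 2" by simp
  from strip_in_rectangle[OF this, of 1 0 "1/2"] obtain R where R: "is_rectangle 1 2 R"
    and sub: "{z\<in>unit_square. \<bar>z$2 - 0 * z$1 - 1/2\<bar> \<le> 1/2} \<subseteq> R" by auto
  have "\<bar>z$2 - 0 * z$1 - 1/2\<bar> \<le> 1/2" if "z \<in> unit_square" for z
  proof -
    have "\<bar>z$2 - 1/2\<bar> \<le> 1/2" using that[unfolded mem_unit_square, rule_format, of 2] by linarith
    then show ?thesis by simp
  qed
  then have "unit_square \<subseteq> R" using sub by blast
  then have "{t\<in>T. t \<subseteq> R} = T" using T unfolding tube_set_def by blast
  then show "finite T" "real (card T) \<le> K * (1/\<delta>) powr \<alpha>"
    using T[unfolded tube_set_def, THEN conjunct2, rule_format, of 1 R] assms(2) R by auto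
qed

text \<open>
  A set with this property is treated as a line of slope at most 1, with \<open>i\<close> the horizontal and \<open>j\<close> the
  vertical axis. The bound on the slope keeps distances to the line and vertical offsets comparable.
\<close>

definition gentle :: "real \<Rightarrow> 2 \<Rightarrow> 2 \<Rightarrow> (real^2) set \<Rightarrow> bool" where
  "gentle \<delta> i j t \<longleftrightarrow> (\<exists>m b. \<bar>m\<bar> \<le> 1 \<and> (\<forall>z\<in>t. \<bar>z$j - m * z$i - b\<bar> \<le> 2 * \<delta>))"

text \<open>
  The long side of the tube makes an angle of at most 45 degrees with one of the two axes.
\<close>

lemma tube_gentle:
  assumes "is_tube \<delta> t" "0 < \<delta>"
  shows "gentle \<delta> 1 2 t \<or> gentle \<delta> 2 1 t"
proof -
  obtain x u v where u: "norm u = 1" and v: "norm v = 1"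
    and t: "t = {x + s *\<^sub>R u + r *\<^sub>R v | s r. 0 \<le> s \<and> s \<le> \<delta> \<and> 0 \<le> r \<and> r \<le> 1}"
    using assms(1) unfolding is_tube_def is_rectangle_def by blast
  have main: "gentle \<delta> i j t" if le: "\<bar>v$j\<bar> \<le> \<bar>v$i\<bar>" and ij: "i \<noteq> j" for i j
  proof -
    have v0: "v$i \<noteq> 0"
    proof
      assume "v$i = 0"
      then have "v$k = 0" for k using le index_pair_2[OF ij, of k] by auto
      then have "v = 0" by (simp add: vec_eq_iff)
      then show False using v by simp
    qed
    define m where "m = v$j / v$i"
    have m1: "\<bar>m\<bar> \<le> 1" unfolding m_def using le v0 by (simp add: abs_divide)
    have vm: "v$j = m * v$i" unfolding m_def using v0 by simp
    have "\<bar>z$j - m * z$i - (x$j - m * x$i)\<bar> \<le> 2 * \<delta>" if zt: "z \<in> t" for z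
    proof -
      obtain s r where s: "0 \<le> s" "s \<le> \<delta>" and z: "z = x + s *\<^sub>R u + r *\<^sub>R v"
        using zt by (auto simp: t)
      have "z$j - m * z$i - (x$j - m * x$i) = s * (u$j - m * u$i)"
        unfolding z by (simp add: vm algebra_simps)
      moreover have "\<bar>u$j - m * u$i\<bar> \<le> 2"
      proof -
        have "\<bar>u$j\<bar> \<le> 1" "\<bar>u$i\<bar> \<le> 1"
          using component_le_norm_cart[of u j] component_le_norm_cart[of u i] u by simp_all
        moreover have "\<bar>m * u$i\<bar> \<le> 1 * \<bar>u$i\<bar>" unfolding abs_mult using m1 by (intro mult_right_mono) auto
        ultimately show ?thesis by linarith
      qed
      moreover have "\<bar>s\<bar> \<le> \<delta>" using s by simp
      ultimately have "\<bar>z$j - m * z$i - (x$j - m * x$i)\<bar> \<le> \<delta> * 2"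
        using assms(2) by (simp only: abs_mult) (intro mult_mono, auto)
      then show ?thesis by simp
    qed
    then show ?thesis unfolding gentle_def using m1 by blast
  qed
  show ?thesis using main[of 2 1] main[of 1 2] by (cases "\<bar>v$2\<bar> \<le> \<bar>v$1\<bar>") auto
qed

text \<open>
  A box of half-width \<open>r\<close> in line space corresponds to a strip: within the unit square, lines with slope
  and intercept in the box deviate by at most \<open>2 r\<close> from the central one.
\<close>

lemma tube_set_count:
  assumes T: "tube_set \<delta> \<alpha> K T" and d: "0 < \<delta>" "\<delta> \<le> 1" and r: "\<delta> \<le> r"
    and al: "0 \<le> \<alpha>" "\<alpha> \<le> 2" and K: "0 \<le> K" and ij: "i \<noteq> j"
    and near: "\<And>t z. t \<in> T \<Longrightarrow> z \<in> t \<Longrightarrow> \<bar>z$j - m t * z$i - b t\<bar> \<le> 2 * \<delta>"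
  shows "real (card {t\<in>T. \<bar>m t - m0\<bar> \<le> r \<and> \<bar>b t - b0\<bar> \<le> r}) \<le> 64 * K * (r/\<delta>) powr \<alpha>"
    (is "real (card ?S) \<le> _")
proof -
  have "real (card ?S) \<le> K * (8 * (r/\<delta>)) powr \<alpha>"
  proof (cases "8 * r \<le> 1")
    case True
    obtain R where R: "is_rectangle (8*r) 2 R"
      and sub: "{z\<in>unit_square. \<bar>z$j - m0 * z$i - b0\<bar> \<le> 8*r/2} \<subseteq> R"
      using strip_in_rectangle[OF ij, of "8*r" m0 b0] d r by auto
    have "?S \<subseteq> {t\<in>T. t \<subseteq> R}"
    proof clarify
      fix t z assume t: "t \<in> T" "\<bar>m t - m0\<bar> \<le> r" "\<bar>b t - b0\<bar> \<le> r" and z: "z \<in> t"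
      have zu: "z \<in> unit_square" using T t(1) z unfolding tube_set_def by blast
      then have "0 \<le> z$i" "z$i \<le> 1" unfolding mem_unit_square by auto
      then have "\<bar>(m t - m0) * z$i\<bar> \<le> r * 1"
        unfolding abs_mult using t d r by (intro mult_mono) auto
      moreover have "z$j - m0 * z$i - b0 = (z$j - m t * z$i - b t) + (m t - m0) * z$i + (b t - b0)"
        by (simp add: algebra_simps)
      ultimately have "\<bar>z$j - m0 * z$i - b0\<bar> \<le> 8*r/2"
        using near[OF t(1) z] t(3) r by linarith
      then show "z \<in> R" using sub zu by blast
    qed
    moreover have "finite {t\<in>T. t \<subseteq> R}"
      and B: "real (card {t\<in>T. t \<subseteq> R}) \<le> K * (8*r/\<delta>) powr \<alpha>"
      using T[unfolded tube_set_def, THEN conjunct2, rule_format, of "8*r" R] True d r R by auto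
    ultimately have "real (card ?S) \<le> real (card {t\<in>T. t \<subseteq> R})"
      by (simp add: card_mono)
    then show ?thesis using B by simp
  next
    case False
    have "real (card ?S) \<le> real (card T)" using tube_set_card(1)[OF T d(2)] by (simp add: card_mono)
    also have "\<dots> \<le> K * (1/\<delta>) powr \<alpha>" by (rule tube_set_card(2)[OF T d(2)])
    also have "\<dots> \<le> K * (8 * (r/\<delta>)) powr \<alpha>"
      using False d K al by (intro mult_left_mono powr_mono2) (auto simp: field_simps)
    finally show ?thesis .
  qed
  also have "\<dots> \<le> K * (8^2 * (r/\<delta>) powr \<alpha>)"
    using assms by (intro mult_left_mono powr_scaled_le) auto
  finally show ?thesis by simp
qed

lemma gentle_incidences:
  assumes P: "ball_set \<delta> \<beta> K\<^sub>\<beta> P" and T: "tube_set \<delta> \<alpha> K\<^sub>\<alpha> T"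
    and gentle: "\<And>t. t \<in> T \<Longrightarrow> gentle \<delta> i j t" and ij: "i \<noteq> j"
    and d: "0 < \<delta>" "\<delta> \<le> 1" "1 \<le> 2^M * \<delta>" and K: "1 \<le> K\<^sub>\<alpha>" "1 \<le> K\<^sub>\<beta>"
    and exps: "0 \<le> \<alpha>" "\<alpha> \<le> 2" "0 \<le> \<beta>" "\<beta> \<le> 2" "3 \<le> \<alpha> + \<beta>" and c: "c = 1 / (\<alpha> + \<beta> - 1)"
  shows "real (incidences P T) \<le> 110000 * (real M + 1)^2 * \<delta> powr (-c)
     * (9 * K\<^sub>\<beta> * (64 * K\<^sub>\<alpha>)) powr c * (real (card P) * real (card T)) powr (1 - c)"
proof -
  have "\<forall>p\<in>P. \<exists>z. p = cball z \<delta>" using P unfolding ball_set_def is_ball_def by blast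
  then obtain z where z: "\<And>p. p \<in> P \<Longrightarrow> p = cball (z p) \<delta>" by metis
  obtain m b where m: "\<And>t. t \<in> T \<Longrightarrow> \<bar>m t\<bar> \<le> 1"
    and near: "\<And>t q. t \<in> T \<Longrightarrow> q \<in> t \<Longrightarrow> \<bar>q$j - m t * q$i - b t\<bar> \<le> 2 * \<delta>"
    using gentle unfolding gentle_def by metis
  have zs: "z p \<in> unit_square" if "p \<in> P" for p
    using z[OF that] P that d unfolding ball_set_def by (metis centre_in_cball less_imp_le subsetD)
  interpret spaced_config P "\<lambda>p. z p $ i" "\<lambda>p. z p $ j" T m b \<delta> \<alpha> \<beta> "9 * K\<^sub>\<beta>" "64 * K\<^sub>\<alpha>" M
  proof
    show "finite P" "finite T" using ball_set_card(1)[OF P d(2)] tube_set_card(1)[OF T d(2)] .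
    show "0 \<le> z p $ i \<and> z p $ i \<le> 1 \<and> 0 \<le> z p $ j \<and> z p $ j \<le> 1" if "p \<in> P" for p
      using zs[OF that] unfolding mem_unit_square by blast
    show "real (card {q\<in>P. \<bar>z q $ i - z p $ i\<bar> \<le> r \<and> \<bar>z q $ j - z p $ j\<bar> \<le> r}) \<le> 9 * K\<^sub>\<beta> * (r/\<delta>) powr \<beta>"
      if "\<delta> \<le> r" for p r
      by (rule ball_set_count[OF P d(1,2) that]) (use exps K ij z in auto)
    show "real (card {t\<in>T. \<bar>m t - m0\<bar> \<le> r \<and> \<bar>b t - b0\<bar> \<le> r}) \<le> 64 * K\<^sub>\<alpha> * (r/\<delta>) powr \<alpha>"
      if "\<delta> \<le> r" for r m0 b0
      by (rule tube_set_count[OF T d(1,2) that]) (use exps K ij near in auto)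
  qed (use d K exps m in auto)
  let ?I = "{(p,t). p \<in> P \<and> t \<in> T \<and> \<bar>z p $ j - m t * z p $ i - b t\<bar> \<le> 4 * \<delta>}"
  have sub: "{(p, t). p \<in> P \<and> t \<in> T \<and> p \<inter> t \<noteq> {}} \<subseteq> ?I"
  proof clarify
    fix p t assume p: "p \<in> P" and t: "t \<in> T" and "p \<inter> t \<noteq> {}"
    then obtain q where q: "q \<in> p" "q \<in> t" by blast
    have "norm (z p - q) \<le> \<delta>" using q(1) z[OF p] by (auto simp: dist_norm)
    then have qk: "\<bar>z p $ k - q $ k\<bar> \<le> \<delta>" for k
      using component_le_norm_cart[of "z p - q" k] by simp
    have "\<bar>m t * (z p $ i - q $ i)\<bar> \<le> 1 * \<delta>"
      unfolding abs_mult using m[OF t] qk[of i] by (intro mult_mono) auto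
    moreover have "z p $ j - m t * z p $ i - b t
        = (q$j - m t * q$i - b t) + (z p $ j - q $ j) - m t * (z p $ i - q $ i)"
      by (simp add: algebra_simps)
    ultimately show "\<bar>z p $ j - m t * z p $ i - b t\<bar> \<le> 4 * \<delta>"
      using near[OF t q(2)] qk[of j] by linarith
  qed
  have "finite ?I" by (rule finite_subset[of _ "P \<times> T"]) (use finite_P finite_T in auto)
  then have "real (incidences P T) \<le> real (card ?I)"
    unfolding incidences_def using sub by (simp add: card_mono)
  also have "\<dots> \<le> 110000 * (real M + 1)^2 * \<delta> powr (-c)
     * (9 * K\<^sub>\<beta> * (64 * K\<^sub>\<alpha>)) powr c * (real (card P) * real (card T)) powr (1 - c)"
  proof (rule incidence_bound[OF exps(5) c])
    have "real (card P) \<le> K\<^sub>\<beta> * (1/\<delta>) powr \<beta>" by (rule ball_set_card(2)[OF P d(2)])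
    also have "\<dots> \<le> 9 * K\<^sub>\<beta> * (1/\<delta>) powr \<beta>" using K by (intro mult_right_mono) auto
    finally show "real (card P) \<le> 9 * K\<^sub>\<beta> * \<delta> powr (-\<beta>)" using d by (simp add: powr_minus_divide powr_divide)
    have "real (card T) \<le> K\<^sub>\<alpha> * (1/\<delta>) powr \<alpha>" by (rule tube_set_card(2)[OF T d(2)])
    also have "\<dots> \<le> 64 * K\<^sub>\<alpha> * (1/\<delta>) powr \<alpha>" using K by (intro mult_right_mono) auto
    finally show "real (card T) \<le> 64 * K\<^sub>\<alpha> * \<delta> powr (-\<alpha>)" using d by (simp add: powr_minus_divide powr_divide)
  qed
  finally show ?thesis .
qed

section \<open>The incidence estimate\<close>

lemma square_le_exponential:
  fixes e :: real
  assumes "0 < e"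
  shows "\<exists>C>0. \<forall>n::nat. (real n + 1)^2 \<le> C * 2 powr (e * n)"
proof -
  define s where "s = e * ln 2"
  have s: "0 < s" unfolding s_def using assms by simp
  have "(real n + 1)^2 \<le> (2 * (1 + 2/s^2)) * 2 powr (e * n)" for n :: nat
  proof -
    have ex: "2 powr (e * n) = exp (s * n)" by (simp add: powr_def s_def algebra_simps)
    have "1 + s*n + (s*n)^2/2 \<le> exp (s * n)" by (rule exp_lower_Taylor_quadratic) (use s in simp)
    moreover have "0 \<le> s * n" using s by simp
    ultimately have "(s*n)^2/2 \<le> exp (s*n)" and e1: "1 \<le> exp (s*n)" by auto
    then have "(real n)^2 \<le> 2/s^2 * exp (s*n)" using s by (simp add: field_simps)
    moreover have "(real n + 1)^2 \<le> 2 * (real n)^2 + 2"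
      using sum_squares_bound[of "real n" 1] by (simp add: power2_eq_square algebra_simps)
    ultimately have "(real n + 1)^2 \<le> 2 * (2/s^2 * exp (s*n)) + 2 * exp (s*n)" using e1 by linarith
    then show ?thesis unfolding ex by (simp add: algebra_simps)
  qed
  moreover have "0 < 2 * (1 + 2/s^2)" using s by (simp add: add_pos_pos)
  ultimately show ?thesis by blast
qed

theorem theorem1p5:
  fixes \<alpha> \<beta> \<epsilon> c :: real
  assumes "0 \<le> \<alpha>" "\<alpha> \<le> 2" "0 \<le> \<beta>" "\<beta> \<le> 2" "\<epsilon> > 0"
    and "c = 1 / max (\<alpha> + \<beta> - 1) 2"
  shows "\<exists>C>0. \<forall>\<delta> K\<^sub>\<alpha> K\<^sub>\<beta> P T.
    0 < \<delta> \<and> \<delta> \<le> 1 \<and> K\<^sub>\<alpha> \<ge> 1 \<and> K\<^sub>\<beta> \<ge> 1 \<and> ball_set \<delta> \<beta> K\<^sub>\<beta> P \<and> tube_set \<delta> \<alpha> K\<^sub>\<alpha> T \<longrightarrow>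
    real (incidences P T) \<le> C * \<delta> powr (- c - \<epsilon>) * (K\<^sub>\<alpha> * K\<^sub>\<beta>) powr c
      * real (card P) powr (1 - c) * real (card T) powr (1 - c)"
proof -
  obtain C where C: "0 < C" "\<And>n::nat. (real n + 1)^2 \<le> C * 2 powr (\<epsilon> * n)"
    using square_le_exponential[OF assms(5)] by blast
  \<comment> \<open>Exponents in \<open>[0, 2]\<close> above the given ones with sum \<open>max (\<alpha> + \<beta>) 3\<close>.\<close>
  define a where "a = max \<alpha> 1"
  define b where "b = max \<beta> (3 - a)"
  have ab: "\<alpha> \<le> a" "\<beta> \<le> b" "0 \<le> a" "a \<le> 2" "0 \<le> b" "b \<le> 2" "3 \<le> a + b"
    using assms by (auto simp: a_def b_def max_def)
  have cab: "c = 1 / (a + b - 1)" using assms by (auto simp: a_def b_def max_def)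
  have c: "0 < c" "c \<le> 1" unfolding cab using ab(7) by simp_all
  define C' where "C' = 2 * 110000 * 576 * (C * 2 powr \<epsilon>)"
  have "real (incidences P T) \<le> C' * \<delta> powr (- c - \<epsilon>) * (K\<^sub>\<alpha> * K\<^sub>\<beta>) powr c
      * real (card P) powr (1 - c) * real (card T) powr (1 - c)"
    if d: "0 < \<delta>" "\<delta> \<le> 1" and K: "1 \<le> K\<^sub>\<alpha>" "1 \<le> K\<^sub>\<beta>"
      and P: "ball_set \<delta> \<beta> K\<^sub>\<beta> P" and T: "tube_set \<delta> \<alpha> K\<^sub>\<alpha> T" for \<delta> K\<^sub>\<alpha> K\<^sub>\<beta> P T
  proof -
    \<comment> \<open>The number of scales is logarithmic in \<open>1 / \<delta>\<close>; its square is absorbed by \<open>\<delta> powr (-\<epsilon>)\<close>.\<close>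
    define M where "M = nat \<lceil>log 2 (1/\<delta>)\<rceil>"
    have lg: "0 \<le> log 2 (1/\<delta>)" using d by simp
    have M: "log 2 (1/\<delta>) \<le> real M" "real M \<le> log 2 (1/\<delta>) + 1"
      unfolding M_def using lg by linarith+
    have "1/\<delta> = 2 powr (log 2 (1/\<delta>))" using d by simp
    also have "\<dots> \<le> 2 powr (real M)" using M(1) by simp
    also have "\<dots> = 2^M" by (simp add: powr_realpow)
    finally have M\<delta>: "1 \<le> 2^M * \<delta>" using d by (simp add: field_simps)
    have "2 powr (\<epsilon> * M) \<le> 2 powr (\<epsilon> * (log 2 (1/\<delta>) + 1))"
      using M(2) assms(5) by simp
    also have "\<dots> = 2 powr \<epsilon> * (2 powr (log 2 (1/\<delta>))) powr \<epsilon>"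
      by (simp add: powr_powr distrib_left powr_add mult.commute)
    also have "\<dots> = 2 powr \<epsilon> * \<delta> powr (-\<epsilon>)" using d by (simp add: powr_minus_divide powr_divide)
    finally have logs: "(real M + 1)^2 \<le> C * 2 powr \<epsilon> * \<delta> powr (-\<epsilon>)"
      using C(2)[of M] mult_left_mono[of _ _ C] C(1) by (smt (verit) mult.assoc)
    have P': "ball_set \<delta> b K\<^sub>\<beta> P" using ball_set_mono[OF P ab(2) d(1)] K by simp
    have T': "tube_set \<delta> a K\<^sub>\<alpha> T" using tube_set_mono[OF T ab(1) d(1)] K by simp
    have finP: "finite P" and finT: "finite T"
      using ball_set_card(1)[OF P d(2)] tube_set_card(1)[OF T d(2)] .
    define E where "E = C' / 2 * \<delta> powr (- c - \<epsilon>) * (K\<^sub>\<alpha> * K\<^sub>\<beta>) powr c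
      * real (card P) powr (1 - c) * real (card T) powr (1 - c)"
    have half: "real (incidences P {t\<in>T. gentle \<delta> i j t}) \<le> E" if ij: "i \<noteq> j" for i j
    proof -
      let ?T = "{t\<in>T. gentle \<delta> i j t}"
      have dpow: "\<delta> powr (- c - \<epsilon>) = \<delta> powr (-c) * \<delta> powr (-\<epsilon>)"
        unfolding powr_add[symmetric] by simp
      have ppow: "(real (card P) * real (card T)) powr (1 - c) = real (card P) powr (1 - c) * real (card T) powr (1 - c)"
        by (rule powr_mult)
      have subset: "tube_set \<delta> a K\<^sub>\<alpha> ?T"
        unfolding tube_set_def
      proof (intro conjI allI impI)
        show "\<forall>t\<in>?T. is_tube \<delta> t \<and> t \<subseteq> unit_square" using T' unfolding tube_set_def by blast
        fix w R assume w: "\<delta> \<le> w \<and> w \<le> 1 \<and> is_rectangle w 2 R"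
        then have fin: "finite {t\<in>T. t \<subseteq> R}" and le: "real (card {t\<in>T. t \<subseteq> R}) \<le> K\<^sub>\<alpha> * (w/\<delta>) powr a"
          using T' unfolding tube_set_def by blast+
        have s: "{t\<in>?T. t \<subseteq> R} \<subseteq> {t\<in>T. t \<subseteq> R}" by blast
        show "finite {t\<in>?T. t \<subseteq> R}" by (rule finite_subset[OF s fin])
        show "real (card {t\<in>?T. t \<subseteq> R}) \<le> K\<^sub>\<alpha> * (w/\<delta>) powr a"
          using card_mono[OF fin s] le by linarith
      qed
      have "real (incidences P ?T) \<le> 110000 * (real M + 1)^2 * \<delta> powr (-c)
          * (9 * K\<^sub>\<beta> * (64 * K\<^sub>\<alpha>)) powr c * (real (card P) * real (card ?T)) powr (1 - c)"
        by (rule gentle_incidences[OF P' subset _ ij d M\<delta> K ab(3-7) cab]) simp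
      also have "\<dots> \<le> 110000 * (C * 2 powr \<epsilon> * \<delta> powr (-\<epsilon>)) * \<delta> powr (-c)
          * (576 * (K\<^sub>\<alpha> * K\<^sub>\<beta>) powr c) * (real (card P) * real (card T)) powr (1 - c)"
      proof -
        have "9 * K\<^sub>\<beta> * (64 * K\<^sub>\<alpha>) = 576 * (K\<^sub>\<alpha> * K\<^sub>\<beta>)" by simp
        then have "(9 * K\<^sub>\<beta> * (64 * K\<^sub>\<alpha>)) powr c = 576 powr c * (K\<^sub>\<alpha> * K\<^sub>\<beta>) powr c"
          using K by (simp only: powr_mult)
        also have "\<dots> \<le> 576 powr 1 * (K\<^sub>\<alpha> * K\<^sub>\<beta>) powr c"
          using c by (intro mult_right_mono powr_mono) auto
        finally have k: "(9 * K\<^sub>\<beta> * (64 * K\<^sub>\<alpha>)) powr c \<le> 576 * (K\<^sub>\<alpha> * K\<^sub>\<beta>) powr c" by simp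
        have "real (card ?T) \<le> real (card T)" using card_mono[OF finT, of ?T] by auto
        then have x: "(real (card P) * real (card ?T)) powr (1 - c) \<le> (real (card P) * real (card T)) powr (1 - c)"
          using c by (intro powr_mono2 mult_left_mono) auto
        show ?thesis using C(1) by (intro mult_mono logs k x order_refl) auto
      qed
      also have "\<dots> = E"
        unfolding E_def C'_def dpow ppow by (simp add: ac_simps)
      finally show ?thesis .
    qed
    let ?I = "\<lambda>T. {(p, t). p \<in> P \<and> t \<in> T \<and> p \<inter> t \<noteq> {}}"
    have "?I T \<subseteq> ?I {t\<in>T. gentle \<delta> 1 2 t} \<union> ?I {t\<in>T. gentle \<delta> 2 1 t}"
      using T tube_gentle[OF _ d(1)] unfolding tube_set_def by blast
    moreover have fin: "finite (?I T')" if "T' \<subseteq> T" for T'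
      by (rule finite_subset[of _ "P \<times> T"]) (use finP finT that in auto)
    ultimately have "incidences P T \<le> card (?I {t\<in>T. gentle \<delta> 1 2 t} \<union> ?I {t\<in>T. gentle \<delta> 2 1 t})"
      unfolding incidences_def by (intro card_mono finite_UnI fin) auto
    also have "\<dots> \<le> incidences P {t\<in>T. gentle \<delta> 1 2 t} + incidences P {t\<in>T. gentle \<delta> 2 1 t}"
      unfolding incidences_def by (rule card_Un_le)
    finally have "real (incidences P T) \<le> E + E"
      using half[of 1 2] half[of 2 1] by simp
    then show ?thesis unfolding E_def by (simp add: ac_simps)
  qed
  moreover have "0 < C'" unfolding C'_def using C by simp
  ultimately show ?thesis by blast
qed

end
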